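(* Let $d=1$, $1\le p\le\infty$, $h>0$, $N\in\mathbb N$, $\varphi\in L_p(\mathbb R)$, and let $M\ge2$ be an integer (a positive dilation factor). Suppose $f\in W_1^{N+1}$, and let $$\varepsilon_j(k)=\frac{M^j}{2h}\int_{-M^{-j}h}^{M^{-j}h}f(M^{-j}k+t)\,dt-Lf(M^{-j}\cdot)(k),\qquad k\in\mathbb Z,$$ where $$Lf=\sum_{l=0}^{N}a_lf^{(l)},\qquad a_l=\frac1{l!\,2h}\int_{-h}^{h}t^l\,dt.$$ Then there is a constant $C$ not depending on $j$ such that for all $j\in\mathbb Z_+$ $$\Big\|M^{-j/2}\sum_{k\in\mathbb Z}\varepsilon_j(-k)\,\varphi_{jk}\Big\|_p\le C\,M^{-j(N+\frac1p)}.$$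
   Context: $\mathbb Z_+=\{0,1,2,\dots\}$. $W_1^{N+1}$ is the Sobolev space of functions on $\mathbb R$ whose derivatives up to order $N+1$ are in $L_1(\mathbb R)$; $f$ is identified with its $N$ times continuously differentiable representative. $\varphi_{jk}(x)=M^{j/2}\varphi(M^jx+k)$. $Lf(M^{-j}\cdot)(k)$ denotes the value at the point $k$ of $L$ applied to the function $x\mapsto f(M^{-j}x)$. For $p=\infty$, $1/p=0$. *)

theory Defs
  imports "HOL-Analysis.Analysis" "HOL-Probability.Essential_Supremum"
begin

subsection \<open>Lebesgue spaces on the real line\<close>

definition in_Lp :: "ereal \<Rightarrow> (real \<Rightarrow> 'a::real_normed_vector) \<Rightarrow> bool" where
  "in_Lp p f \<longleftrightarrow> f \<in> borel_measurable lebesgue \<and>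
     (if p = \<infinity> then esssup lebesgue (\<lambda>x. ereal (norm (f x))) < \<infinity>
      else integrable lebesgue (\<lambda>x. norm (f x) powr real_of_ereal p))"

text \<open>The value is meaningful only when \<open>in_Lp p f\<close> holds (and \<open>1 \<le> p\<close>).\<close>

definition Lp_norm :: "ereal \<Rightarrow> (real \<Rightarrow> 'a::real_normed_vector) \<Rightarrow> real" where
  "Lp_norm p f =
     (if p = \<infinity> then real_of_ereal (esssup lebesgue (\<lambda>x. ereal (norm (f x))))
      else (LINT x|lebesgue. norm (f x) powr real_of_ereal p) powr (1 / real_of_ereal p))"

text \<open>Unconditional convergence, in \<open>L\<^sub>p\<close>, of the series of the functions \<open>u k\<close>, to the sum \<open>s\<close>.\<close>

definition Lp_has_sum ::
    "ereal \<Rightarrow> ('i \<Rightarrow> real \<Rightarrow> 'a::real_normed_vector) \<Rightarrow> (real \<Rightarrow> 'a) \<Rightarrow> bool" where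
  "Lp_has_sum p u s \<longleftrightarrow> (\<forall>k. in_Lp p (u k)) \<and> in_Lp p s \<and>
     ((\<lambda>F. Lp_norm p (\<lambda>x. (\<Sum>k\<in>F. u k x) - s x)) \<longlongrightarrow> 0) (finite_subsets_at_top UNIV)"

subsection \<open>Classical and weak derivatives, Sobolev spaces\<close>

definition nth_deriv :: "nat \<Rightarrow> (real \<Rightarrow> 'a::real_normed_vector) \<Rightarrow> real \<Rightarrow> 'a" where
  "nth_deriv n f = ((\<lambda>g x. vector_derivative g (at x)) ^^ n) f"

definition cont_diff :: "nat \<Rightarrow> (real \<Rightarrow> 'a::real_normed_vector) \<Rightarrow> bool" where
  "cont_diff n f \<longleftrightarrow> (\<forall>m<n. \<forall>x. nth_deriv m f differentiable (at x)) \<and>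
     (\<forall>m\<le>n. continuous_on UNIV (nth_deriv m f))"

definition test_function :: "(real \<Rightarrow> real) \<Rightarrow> bool" where
  "test_function \<psi> \<longleftrightarrow> (\<forall>n. cont_diff n \<psi>) \<and> (\<exists>R. \<forall>x. R < \<bar>x\<bar> \<longrightarrow> \<psi> x = 0)"

text \<open>Intended for locally integrable \<open>f\<close> and \<open>g\<close>. Real test functions suffice, also for
  complex-valued \<open>f\<close> and \<open>g\<close>, because both sides are linear in the test function.\<close>

definition weak_deriv :: "nat \<Rightarrow> (real \<Rightarrow> complex) \<Rightarrow> (real \<Rightarrow> complex) \<Rightarrow> bool" where
  "weak_deriv n f g \<longleftrightarrow> (\<forall>\<psi>. test_function \<psi> \<longrightarrow>
     (LINT x|lebesgue. nth_deriv n \<psi> x *\<^sub>R f x) = (-1) ^ n * (LINT x|lebesgue. \<psi> x *\<^sub>R g x))"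

definition sobolev_W1 :: "nat \<Rightarrow> (real \<Rightarrow> complex) \<Rightarrow> bool" where
  "sobolev_W1 n f \<longleftrightarrow> integrable lebesgue f \<and>
     (\<forall>l\<le>n. \<exists>g. integrable lebesgue g \<and> weak_deriv l f g)"

subsection \<open>The differential operator, the scaled functions and the coefficients\<close>

definition diff_op_coeff :: "real \<Rightarrow> nat \<Rightarrow> real" where
  "diff_op_coeff h l = 1 / (fact l * (2 * h)) * integral {-h..h} (\<lambda>t. t ^ l)"

definition diff_op :: "real \<Rightarrow> nat \<Rightarrow> (real \<Rightarrow> complex) \<Rightarrow> real \<Rightarrow> complex" where
  "diff_op h N f x = (\<Sum>l=0..N. diff_op_coeff h l *\<^sub>R nth_deriv l f x)"

definition scaled_shift :: "int \<Rightarrow> (real \<Rightarrow> complex) \<Rightarrow> nat \<Rightarrow> int \<Rightarrow> real \<Rightarrow> complex" where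
  "scaled_shift M \<phi> j k x =
     (of_int M powr (real j / 2)) *\<^sub>R \<phi> (of_int M ^ j * x + of_int k)"

definition eps_coeff ::
    "real \<Rightarrow> nat \<Rightarrow> int \<Rightarrow> (real \<Rightarrow> complex) \<Rightarrow> nat \<Rightarrow> int \<Rightarrow> complex" where
  "eps_coeff h N M f j k =
     (of_int M ^ j / (2 * h)) *\<^sub>R
        integral {- (h / of_int M ^ j)..h / of_int M ^ j} (\<lambda>t. f (of_int k / of_int M ^ j + t))
     - diff_op h N (\<lambda>x. f (x / of_int M ^ j)) (of_int k)"

end

theory Submission
  imports Defs
begin

text \<open>Let \<open>g\<close> be the weak derivative of \<open>f\<close> of order \<open>N + 1\<close>. Increments of \<open>f\<^sup>(\<^sup>N\<^sup>)\<close> are integrals of \<open>g\<close>.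
  The operator \<open>L\<close> is chosen so that the Taylor polynomial of order \<open>N\<close> cancels in \<open>\<epsilon>\<^sub>j(k)\<close>; with
  \<open>\<delta> = h M\<^sup>-\<^sup>j\<close>, the remainder gives
  \<open>\<bar>\<epsilon>\<^sub>j(k)\<bar> \<le> \<delta>\<^sup>N \<integral> \<bar>g\<bar>\<close>, integrated over the interval of radius \<open>\<delta>\<close> around \<open>M\<^sup>-\<^sup>j k\<close>. These
  intervals cover each point at most \<open>2 h + 1\<close> times, so the \<open>\<epsilon>\<^sub>j(k)\<close> are absolutely summable over
  \<open>k\<close> with sum of order \<open>M\<^sup>-\<^sup>j\<^sup>N\<close>. The functions \<open>\<phi>\<^sub>j\<^sub>k\<close> all have the same norm,
  \<open>M\<^sup>j\<^sup>/\<^sup>2\<close> times \<open>M\<^sup>-\<^sup>j\<^sup>/\<^sup>p\<close> times the norm of \<open>\<phi>\<close>, and the triangle inequality finishes the proof.\<close>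

subsection \<open>Derivative sequences and smooth steps\<close>

text \<open>\<open>nth_deriv\<close> iterates the choice-based \<open>vector_derivative\<close>;
  uniqueness of derivatives identifies it with explicit candidates \<open>D m\<close>. The cut-off
  \<open>n\<close> admits functions of finite smoothness.\<close>

lemma nth_deriv_eq:
  assumes "\<And>m x. m < n \<Longrightarrow> (D m has_vector_derivative D (Suc m) x) (at x)" and "m \<le> n"
  shows "nth_deriv m (D 0) = D m"
  using assms(2)
proof (induction m)
  case 0
  then show ?case by (simp add: nth_deriv_def)
next
  case (Suc m)
  then have "nth_deriv (Suc m) (D 0) = (\<lambda>x. vector_derivative (D m) (at x))"
    by (simp add: nth_deriv_def)
  also have "\<dots> = D (Suc m)"
    using Suc.prems by (intro ext vector_derivative_at assms(1)) simp
  finally show ?case .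
qed

lemma cont_diff_has_vector_derivative:
  assumes "cont_diff n f" "m < n"
  shows "(nth_deriv m f has_vector_derivative nth_deriv (Suc m) f x) (at x)"
  using assms by (simp add: cont_diff_def nth_deriv_def vector_derivative_works)

text \<open>A smooth function \<open>D 0\<close> carried together with all its derivatives, so that
  smoothness proofs reduce to closed formulas for \<open>D m\<close>.\<close>

definition deriv_chain :: "(nat \<Rightarrow> real \<Rightarrow> 'a::real_normed_vector) \<Rightarrow> bool" where
  "deriv_chain D \<longleftrightarrow> (\<forall>m x. (D m has_vector_derivative D (Suc m) x) (at x))"

lemma deriv_chain_nth_deriv:
  assumes "deriv_chain D"
  shows "nth_deriv m (D 0) = D m"
  using assms by (intro nth_deriv_eq[of m]) (auto simp: deriv_chain_def)

lemma deriv_chain_continuous: "deriv_chain D \<Longrightarrow> continuous_on UNIV (D m)"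
  unfolding deriv_chain_def
  by (meson continuous_at_imp_continuous_on has_vector_derivative_continuous)

lemma deriv_chain_cont_diff:
  assumes D: "deriv_chain D"
  shows "cont_diff n (D 0)"
  using deriv_chain_nth_deriv[OF D] deriv_chain_continuous[OF D] D
  by (simp add: cont_diff_def deriv_chain_def) (blast intro: differentiableI_vector)

lemma deriv_chain_affine:
  assumes "deriv_chain D"
  shows "deriv_chain (\<lambda>m x. c ^ m *\<^sub>R D m (c * (x - a)))"
  unfolding deriv_chain_def
proof (intro allI)
  fix m x
  have "((D m \<circ> (\<lambda>x. c * (x - a))) has_vector_derivative c *\<^sub>R D (Suc m) (c * (x - a))) (at x)"
    using assms unfolding deriv_chain_def
    by (intro vector_diff_chain_at) (auto intro!: derivative_eq_intros simp: has_real_derivative_iff_has_vector_derivative[symmetric])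
  then have "((\<lambda>x. c ^ m *\<^sub>R D m (c * (x - a))) has_vector_derivative
      c ^ m *\<^sub>R (c *\<^sub>R D (Suc m) (c * (x - a)))) (at x)"
    by (intro bounded_linear.has_vector_derivative[OF bounded_linear_scaleR_right]) (simp add: o_def)
  then show "((\<lambda>x. c ^ m *\<^sub>R D m (c * (x - a))) has_vector_derivative
      c ^ Suc m *\<^sub>R D (Suc m) (c * (x - a))) (at x)"
    by (simp add: mult.commute)
qed

lemma deriv_chain_diff:
  "deriv_chain D \<Longrightarrow> deriv_chain E \<Longrightarrow> deriv_chain (\<lambda>m x. D m x - E m x)"
  unfolding deriv_chain_def by (auto intro!: derivative_intros)

text \<open>The Leibniz rule without binomial coefficients: \<open>leibniz D E n i j\<close> is the \<open>n\<close>-th derivative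
  of \<open>D i * E j\<close>.\<close>

fun leibniz :: "(nat \<Rightarrow> real \<Rightarrow> real) \<Rightarrow> (nat \<Rightarrow> real \<Rightarrow> real) \<Rightarrow> nat \<Rightarrow> nat \<Rightarrow> nat \<Rightarrow> real \<Rightarrow> real" where
  "leibniz D E 0 i j x = D i x * E j x"
| "leibniz D E (Suc n) i j x = leibniz D E n (Suc i) j x + leibniz D E n i (Suc j) x"

lemma deriv_chain_leibniz:
  assumes "deriv_chain D" "deriv_chain E"
  shows "deriv_chain (\<lambda>n. leibniz D E n i j)"
proof -
  have "(leibniz D E n i j has_vector_derivative leibniz D E (Suc n) i j x) (at x)" for n x
  \<comment> \<open>The recursion raises either index, so the hypothesis is needed at
    \<open>(Suc i, j)\<close> and at \<open>(i, Suc j)\<close>.\<close>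
  proof (induction n arbitrary: i j)
    case 0
    have "((\<lambda>x. D i x * E j x) has_vector_derivative D (Suc i) x * E j x + D i x * E (Suc j) x) (at x)"
      using assms unfolding deriv_chain_def has_real_derivative_iff_has_vector_derivative[symmetric]
      by (auto intro!: derivative_eq_intros)
    then show ?case by simp
  next
    case (Suc n)
    have "((\<lambda>x. leibniz D E n (Suc i) j x + leibniz D E n i (Suc j) x) has_vector_derivative
        leibniz D E (Suc n) (Suc i) j x + leibniz D E (Suc n) i (Suc j) x) (at x)"
      by (intro derivative_intros Suc.IH)
    then show ?case by simp
  qed
  then show ?thesis by (simp add: deriv_chain_def)
qed

text \<open>\<open>flat_poly n\<close> is the polynomial in \<open>1/x\<close> multiplying \<open>exp (-1/x)\<close> in its \<open>n\<close>-th derivative;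
  since \<open>1/x\<close> has derivative \<open>- (1/x)\<^sup>2\<close>, each step contributes the factor \<open>[:0, 0, 1:]\<close>.\<close>

primrec flat_poly :: "nat \<Rightarrow> real poly" where
  "flat_poly 0 = 1"
| "flat_poly (Suc n) = [:0, 0, 1:] * (flat_poly n - pderiv (flat_poly n))"

definition flat_fun :: "nat \<Rightarrow> real \<Rightarrow> real" where
  "flat_fun n x = (if 0 < x then poly (flat_poly n) (inverse x) * exp (- inverse x) else 0)"

text \<open>With \<open>y = 1 / x\<close> this is the flatness at \<open>0\<close> from the right of
  every function \<open>flat_fun n\<close>.\<close>

lemma tendsto_poly_mult_exp_minus: "((\<lambda>y. poly q y * exp (- y)) \<longlongrightarrow> (0::real)) at_top"
proof -
  have "((\<lambda>y. \<Sum>i\<le>degree q. coeff q i * (y ^ i / exp y)) \<longlongrightarrow> (\<Sum>i\<le>degree q. coeff q i * 0)) at_top"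
    by (intro tendsto_intros tendsto_power_div_exp_0)
  then show ?thesis
    by (simp add: poly_altdef sum_distrib_right exp_minus field_simps sum_divide_distrib)
qed

lemma deriv_chain_flat_fun: "deriv_chain flat_fun"
  unfolding deriv_chain_def has_real_derivative_iff_has_vector_derivative[symmetric]
proof (intro allI)
  fix n and x :: real
  consider "x < 0" | "x = 0" | "0 < x" by linarith
  then show "(flat_fun n has_real_derivative flat_fun (Suc n) x) (at x)"
  proof cases
    case 1
    have "((\<lambda>_. 0) has_real_derivative 0) (at x)" by simp
    then have "(flat_fun n has_real_derivative 0) (at x)"
      by (rule has_field_derivative_transform_within_open[where S = "{..<0}"])
         (use 1 in \<open>auto simp: flat_fun_def\<close>)
    then show ?thesis using 1 by (simp add: flat_fun_def)
  next
    case 2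
    have "((\<lambda>y. flat_fun n y / y) \<longlongrightarrow> 0) (at_left 0)"
      by (rule tendsto_eventually) (auto simp: eventually_at_filter flat_fun_def intro!: always_eventually)
    moreover have "((\<lambda>y. flat_fun n y / y) \<longlongrightarrow> 0) (at_right 0)"
    proof -
      \<comment> \<open>The factor \<open>1 / y\<close> of the difference quotient is absorbed as
        one more power of \<open>inverse y\<close>, which is what \<open>pCons 0\<close>
        does.\<close>
      have "((\<lambda>y. poly (pCons 0 (flat_poly n)) (inverse y) * exp (- inverse y)) \<longlongrightarrow> 0) (at_right 0)"
        by (rule filterlim_compose[OF tendsto_poly_mult_exp_minus filterlim_inverse_at_top_right])
      then show ?thesis
        by (rule Lim_transform_eventually)
           (auto simp: eventually_at_filter flat_fun_def field_simps intro!: always_eventually)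
    qed
    ultimately have "((\<lambda>y. flat_fun n y / y) \<longlongrightarrow> 0) (at 0)"
      by (simp add: filterlim_split_at)
    then show ?thesis using 2 by (simp add: DERIV_def flat_fun_def)
  next
    case 3
    let ?q = "flat_poly n" and ?y = "inverse x"
    have "((\<lambda>x. poly ?q (inverse x) * exp (- inverse x)) has_real_derivative
        flat_fun (Suc n) x) (at x)"
      using 3 by (auto intro!: derivative_eq_intros DERIV_chain2[OF poly_DERIV]
          simp: flat_fun_def algebra_simps power2_eq_square)
    then show ?thesis
      by (rule has_field_derivative_transform_within_open[where S = "{0<..}"])
         (use 3 in \<open>auto simp: flat_fun_def\<close>)
  qed
qed

text \<open>The product of \<open>flat_fun 0 x\<close> and \<open>flat_fun 0 (1 - x)\<close> is a bump on \<open>[0,1]\<close>; its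
  normalised primitive is the smooth step.\<close>

lemma smooth_step_exists:
  obtains H where "deriv_chain H" "\<And>x. x \<le> 0 \<Longrightarrow> H 0 x = 0" "\<And>x. 1 \<le> x \<Longrightarrow> H 0 x = 1"
    "\<And>x. 0 \<le> H 0 x \<and> H 0 x \<le> (1::real)"
proof -
  \<comment> \<open>The derivatives of the reflected function \<open>flat_fun 0 (1 - x)\<close>, in
    the form produced by \<open>deriv_chain_affine\<close>.\<close>
  define E where "E m x = (-1) ^ m *\<^sub>R flat_fun m ((-1) * (x - 1))" for m x
  define \<rho> where "\<rho> n = leibniz flat_fun E n 0 0" for n
  have \<rho>: "deriv_chain \<rho>"
    unfolding \<rho>_def E_def by (intro deriv_chain_leibniz deriv_chain_affine deriv_chain_flat_fun)
  have \<rho>0: "\<rho> 0 x = flat_fun 0 x * flat_fun 0 (1 - x)" for x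
    by (simp add: \<rho>_def E_def)
  have nonneg: "0 \<le> \<rho> 0 x" for x by (simp add: \<rho>0 flat_fun_def)
  have cont: "continuous_on A (\<rho> 0)" for A
    using deriv_chain_continuous[OF \<rho>] continuous_on_subset by blast
  have out: "\<rho> 0 x = 0" if "x \<le> 0 \<or> 1 \<le> x" for x using that by (auto simp: \<rho>0 flat_fun_def)
  \<comment> \<open>The base point \<open>-1\<close> lies strictly left of the bump, so
    \<open>0\<close> is an interior point when the fundamental theorem is applied for
    \<open>x \<ge> 0\<close>.\<close>
  define R where "R x = integral {-1..x} (\<rho> 0)" for x
  have R_const: "R x = R y" if "y \<le> x" "-1 \<le> y" "\<And>t. y \<le> t \<Longrightarrow> t \<le> x \<Longrightarrow> \<rho> 0 t = 0" for x y
  proof -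
    have "R x = R y + integral {y..x} (\<rho> 0)"
      unfolding R_def using that(1,2)
      by (intro Henstock_Kurzweil_Integration.integral_combine[symmetric] integrable_continuous_real cont)
    also have "integral {y..x} (\<rho> 0) = integral {y..x} (\<lambda>_. 0)"
      using that(3) by (intro integral_cong) auto
    finally show ?thesis by simp
  qed
  have R0: "R x = 0" if "x \<le> 0" for x
  proof (cases "-1 \<le> x")
    case True
    then have "R x = R (-1)" using that by (intro R_const) (auto intro: out)
    then show ?thesis by (simp add: R_def)
  qed (simp add: R_def)
  have R1: "R x = R 1" if "1 \<le> x" for x
    using that by (intro R_const) (auto intro: out)
  have mono: "R x \<le> R y" if "x \<le> y" for x y
    unfolding R_def using that
    by (intro integral_subset_le integrable_continuous_real cont) (auto simp: nonneg)
  \<comment> \<open>A continuous nonnegative function with zero integral vanishes, so one positive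
    value makes the total mass \<open>R 1\<close> nonzero.\<close>
  have "\<rho> 0 (1/2) > 0" by (simp add: \<rho>0 flat_fun_def)
  have R1pos: "0 < R 1"
  proof -
    have "R 1 \<noteq> 0"
    proof
      assume "R 1 = 0"
      then have "\<rho> 0 (1/2) = 0"
        unfolding R_def using integral_eq_0_iff[of "-1" 1 "\<rho> 0"] cont nonneg by auto
      with \<open>\<rho> 0 (1/2) > 0\<close> show False by simp
    qed
    then show ?thesis using mono[of 0 1] R0[of 0] by simp
  qed
  have dR: "(R has_vector_derivative \<rho> 0 x) (at x)" for x
  proof (cases "x < 0")
    case True
    have "((\<lambda>_. 0) has_vector_derivative \<rho> 0 x) (at x)" using True by (simp add: out)
    then show ?thesis
      by (rule has_vector_derivative_transform_within_open[where S = "{..<0}"]) (use True R0 in auto)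
  next
    case False
    have "(R has_vector_derivative \<rho> 0 x) (at x within {-1..x+1})"
      unfolding R_def using False by (intro integral_has_vector_derivative cont) auto
    then show ?thesis
      using False by (subst (asm) at_within_Icc_at) auto
  qed
  define H where "H m x = (case m of 0 \<Rightarrow> R x | Suc n \<Rightarrow> \<rho> n x) / R 1" for m x
  have "deriv_chain H"
    unfolding deriv_chain_def
  proof (intro allI)
    fix m x
    show "(H m has_vector_derivative H (Suc m) x) (at x)"
      using dR \<rho> unfolding deriv_chain_def H_def has_real_derivative_iff_has_vector_derivative[symmetric]
      by (cases m) (auto intro!: DERIV_cdivide)
  qed
  moreover have "H 0 x = 0" if "x \<le> 0" for x using R0[OF that] by (simp add: H_def)
  moreover have "H 0 x = 1" if "1 \<le> x" for x using R1[OF that] R1pos by (simp add: H_def)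
  moreover have "0 \<le> H 0 x \<and> H 0 x \<le> 1" for x
    using R1pos mono[of "min x 0" x] mono[of x "max x 1"] R0[of "min x 0"] R1[of "max x 1"]
    by (auto simp: H_def)
  ultimately show ?thesis using that by blast
qed

subsection \<open>Weak derivatives and increments\<close>

lemma continuous_compact_support_integrable:
  fixes w :: "real \<Rightarrow> 'a::euclidean_space"
  assumes w: "continuous_on UNIV w" and supp: "\<And>x. R < \<bar>x\<bar> \<Longrightarrow> w x = 0"
  shows "integrable lebesgue w"
proof -
  have "integrable lborel (\<lambda>x. indicator {-R..R} x *\<^sub>R w x)"
    using w by (intro borel_integrable_compact) (auto intro: continuous_on_subset)
  also have "(\<lambda>x. indicator {-R..R} x *\<^sub>R w x) = w"
    using supp by (force split: split_indicator)
  finally show ?thesis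
    using w by (simp add: integrable_completion borel_measurable_continuous_onI)
qed

lemma has_vector_derivative_compact_support:
  assumes u: "\<And>x. (u has_vector_derivative u' x) (at x)"
    and supp: "\<And>x. R < \<bar>x\<bar> \<Longrightarrow> u x = 0" and x: "R < \<bar>x\<bar>"
  shows "u' x = 0"
proof -
  have "open {x::real. R < \<bar>x\<bar>}" by (intro open_Collect_less continuous_intros)
  have "((\<lambda>_. 0) has_vector_derivative 0) (at x)" by simp
  then have "(u has_vector_derivative 0) (at x)"
    by (rule has_vector_derivative_transform_within_open[where S = "{x. R < \<bar>x\<bar>}"])
       (use x supp \<open>open _\<close> in auto)
  with u show ?thesis using vector_derivative_unique_at by blast
qed

text \<open>The fundamental theorem of calculus on an interval whose end points lie outside the
  support.\<close>

lemma integral_derivative_compact_support: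
  fixes u :: "real \<Rightarrow> 'a::euclidean_space"
  assumes u: "\<And>x. (u has_vector_derivative u' x) (at x)" and u': "continuous_on UNIV u'"
    and supp: "\<And>x. R < \<bar>x\<bar> \<Longrightarrow> u x = 0"
  shows "(LINT x|lebesgue. u' x) = 0"
proof -
  \<comment> \<open>Strictly larger than \<open>R\<close>, and positive whatever the sign of
    \<open>R\<close>.\<close>
  define S where "S = \<bar>R\<bar> + 1"
  note supp' = has_vector_derivative_compact_support[OF u supp]
  have [measurable]: "u' \<in> borel_measurable borel"
    using u' by (rule borel_measurable_continuous_onI)
  have "(LINT x|lborel. u' x) = (LINT x|lborel. indicator {-S..S} x *\<^sub>R u' x)"
    using supp' by (intro Bochner_Integration.integral_cong) (force simp: S_def split: split_indicator)+
  moreover have "(LINT x|lborel. indicator {-S..S} x *\<^sub>R u' x) = u S - u (- S)"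
    using u u' by (intro integral_FTC_Icc)
      (auto simp: S_def intro: has_vector_derivative_at_within continuous_on_subset)
  moreover have "u S = 0" "u (- S) = 0" using supp by (auto simp: S_def)
  ultimately have "(LINT x|lborel. u' x) = 0" by simp
  then show ?thesis by (simp add: integral_completion)
qed

text \<open>The product \<open>\<psi> v\<close> inherits compact support from \<open>\<psi>\<close>,
  so the integral of its derivative is zero.\<close>

lemma integration_by_parts_compact_support:
  fixes \<psi> \<psi>' :: "real \<Rightarrow> real" and v v' :: "real \<Rightarrow> 'a::euclidean_space"
  assumes \<psi>: "\<And>x. (\<psi> has_vector_derivative \<psi>' x) (at x)" and \<psi>': "continuous_on UNIV \<psi>'"
    and v: "\<And>x. (v has_vector_derivative v' x) (at x)" and v': "continuous_on UNIV v'"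
    and supp: "\<And>x. R < \<bar>x\<bar> \<Longrightarrow> \<psi> x = 0"
  shows "(LINT x|lebesgue. \<psi>' x *\<^sub>R v x) = - (LINT x|lebesgue. \<psi> x *\<^sub>R v' x)"
proof -
  note supp' = has_vector_derivative_compact_support[OF \<psi> supp]
  have c\<psi>: "continuous_on UNIV \<psi>" and cv: "continuous_on UNIV v"
    using \<psi> v by (meson continuous_at_imp_continuous_on has_vector_derivative_continuous)+
  have "(LINT x|lebesgue. \<psi> x *\<^sub>R v' x + \<psi>' x *\<^sub>R v x) = 0"
  proof (rule integral_derivative_compact_support[where u = "\<lambda>x. \<psi> x *\<^sub>R v x" and R = R])
    show "((\<lambda>x. \<psi> x *\<^sub>R v x) has_vector_derivative \<psi> x *\<^sub>R v' x + \<psi>' x *\<^sub>R v x) (at x)" for x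
      using \<psi> v unfolding has_real_derivative_iff_has_vector_derivative[symmetric]
      by (intro has_vector_derivative_scaleR)
  qed (use c\<psi> \<psi>' cv v' supp in \<open>auto intro!: continuous_intros\<close>)
  moreover have "integrable lebesgue (\<lambda>x. \<psi> x *\<^sub>R v' x)" "integrable lebesgue (\<lambda>x. \<psi>' x *\<^sub>R v x)"
    using c\<psi> \<psi>' cv v' supp supp'
    by (auto intro!: continuous_compact_support_integrable[where R = R] continuous_intros)
  ultimately show ?thesis
    by (simp add: eq_neg_iff_add_eq_0 add.commute)
qed

lemma deriv_chain_compact_support:
  assumes D: "deriv_chain D" and supp: "\<And>x. R < \<bar>x\<bar> \<Longrightarrow> D 0 x = 0"
  shows "R < \<bar>x\<bar> \<Longrightarrow> D m x = 0"
proof (induction m arbitrary: x)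
  case (Suc m)
  have "\<And>x. (D m has_vector_derivative D (Suc m) x) (at x)" using D by (simp add: deriv_chain_def)
  from has_vector_derivative_compact_support[OF this Suc.IH Suc.prems] show ?case by simp
qed (rule supp)

text \<open>Each integration by parts moves one derivative onto \<open>f\<close> and costs a sign.
  The offset \<open>n\<close> counts the derivatives that stay on the test function; in the
  application exactly one stays.\<close>

lemma cont_diff_iterated_parts:
  fixes f :: "real \<Rightarrow> 'a::euclidean_space" and D :: "nat \<Rightarrow> real \<Rightarrow> real"
  assumes f: "cont_diff N f" and D: "deriv_chain D" and supp: "\<And>x. R < \<bar>x\<bar> \<Longrightarrow> D 0 x = 0"
  shows "m \<le> N \<Longrightarrow> (LINT x|lebesgue. D (n + m) x *\<^sub>R f x) =
    (-1) ^ m *\<^sub>R (LINT x|lebesgue. D n x *\<^sub>R nth_deriv m f x)"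
proof (induction m arbitrary: n)
  case 0
  then show ?case by (simp add: nth_deriv_def)
next
  case (Suc m)
  have "(LINT x|lebesgue. D (n + Suc m) x *\<^sub>R f x) = (-1) ^ m *\<^sub>R (LINT x|lebesgue. D (Suc n) x *\<^sub>R nth_deriv m f x)"
    using Suc.IH[of "Suc n"] Suc.prems by simp
  also have "(LINT x|lebesgue. D (Suc n) x *\<^sub>R nth_deriv m f x) = - (LINT x|lebesgue. D n x *\<^sub>R nth_deriv (Suc m) f x)"
  proof (rule integration_by_parts_compact_support)
    show "(D n has_vector_derivative D (Suc n) x) (at x)" for x using D by (simp add: deriv_chain_def)
    show "(nth_deriv m f has_vector_derivative nth_deriv (Suc m) f x) (at x)" for x
      using f Suc.prems by (intro cont_diff_has_vector_derivative) auto
    show "continuous_on UNIV (nth_deriv (Suc m) f)" using f Suc.prems by (simp add: cont_diff_def)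
  qed (use deriv_chain_continuous[OF D] deriv_chain_compact_support[OF D supp] in auto)
  finally show ?case by simp
qed

text \<open>Testing against smooth steps at \<open>a\<close> and \<open>b\<close>, at scale \<open>1 / (n + 1)\<close>.\<close>

lemma weak_deriv_fundamental_theorem:
  fixes f g :: "real \<Rightarrow> complex"
  assumes f: "cont_diff N f" and g: "integrable lebesgue g" and weak: "weak_deriv (Suc N) f g"
    and ab: "a \<le> b"
  shows "nth_deriv N f b - nth_deriv N f a = (LINT x|lebesgue. indicator {a<..b} x *\<^sub>R g x)"
proof -
  obtain H :: "nat \<Rightarrow> real \<Rightarrow> real" where H: "deriv_chain H" and H0: "\<And>x. x \<le> 0 \<Longrightarrow> H 0 x = 0"
    and H1: "\<And>x. 1 \<le> x \<Longrightarrow> H 0 x = 1" and H01: "\<And>x. 0 \<le> H 0 x \<and> H 0 x \<le> 1"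
    using smooth_step_exists by blast
  define F where "F = nth_deriv N f"
  have contF: "continuous_on A F" for A
    using f unfolding F_def cont_diff_def by (meson continuous_on_subset order_refl subset_UNIV)
  define c where "c n = real (Suc n)" for n
  \<comment> \<open>\<open>S n 0\<close> climbs from 0 at \<open>t\<close> to 1 at
    \<open>t + 1 / c n\<close>, and \<open>S n m\<close> is its derivative of order
    \<open>m\<close>.\<close>
  define S where "S n m x t = c n ^ m *\<^sub>R H m (c n * (x - t))" for n m x t
  have S: "deriv_chain (\<lambda>m x. S n m x t)" for n t
    unfolding S_def using H by (rule deriv_chain_affine)
  have c1: "1 \<le> c n" for n by (simp add: c_def)
  define h where "h = H (Suc 0)"
  have cont_h: "continuous_on UNIV h" unfolding h_def by (rule deriv_chain_continuous[OF H])
  have S1: "S n (Suc 0) x t = c n * h (c n * (x - t))" for n x t by (simp add: S_def h_def)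
  have dH: "(H 0 has_vector_derivative h x) (at x)" for x using H by (simp add: deriv_chain_def h_def)
  have H'0: "h x = 0" if "x < 0 \<or> 1 < x" for x
  proof -
    have const: "((\<lambda>_. d) has_vector_derivative 0) (at x)" for d :: real by simp
    from that have "(H 0 has_vector_derivative 0) (at x)"
    proof
      assume x: "x < 0"
      show ?thesis
        by (rule has_vector_derivative_transform_within_open[OF const, where S = "{..<0}"]) (use x H0 in auto)
    next
      assume x: "1 < x"
      show ?thesis
        by (rule has_vector_derivative_transform_within_open[OF const, where S = "{1<..}"]) (use x H1 in auto)
    qed
    with dH show ?thesis using vector_derivative_unique_at by blast
  qed
  have intH': "(LINT u|lebesgue. h u) = 1"
  proof -
    have [measurable]: "h \<in> borel_measurable borel"
      using cont_h by (rule borel_measurable_continuous_onI)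
    have "(LINT x|lborel. h x) = (LINT x|lborel. indicator {0..1} x *\<^sub>R h x)"
      using H'0 by (intro Bochner_Integration.integral_cong) (auto split: split_indicator)
    moreover have "(LINT x|lborel. indicator {0..1} x *\<^sub>R h x) = H 0 1 - H 0 0"
      using dH cont_h by (intro integral_FTC_Icc) (auto intro: has_vector_derivative_at_within continuous_on_subset)
    ultimately have "(LINT x|lborel. h x) = 1" using H0[of 0] H1[of 1] by simp
    then show ?thesis by (simp add: integral_completion)
  qed
  \<comment> \<open>A non-integrable function has integral 0 by convention, so the value 1 forces
    integrability.\<close>
  have int: "integrable lebesgue (h)"
      using intH' not_integrable_integral_eq[of lebesgue "h"] by fastforce
  \<comment> \<open>The derivatives of the steps have mass one and concentrate at \<open>t\<close>
    from the right, so they recover values of the continuous function \<open>F\<close>.\<close>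
  have average: "(\<lambda>n. LINT x|lebesgue. S n (Suc 0) x t *\<^sub>R F x) \<longlonglongrightarrow> F t"
    and average_int: "integrable lebesgue (\<lambda>x. S n (Suc 0) x t *\<^sub>R F x)" for t n
  proof -
    show "integrable lebesgue (\<lambda>x. S n (Suc 0) x t *\<^sub>R F x)"
    proof (rule continuous_compact_support_integrable[where R = "\<bar>t\<bar> + 1"])
      show "continuous_on UNIV (\<lambda>x. S n (Suc 0) x t *\<^sub>R F x)"
        using deriv_chain_continuous[OF S] contF by (intro continuous_intros)
      fix x assume "\<bar>t\<bar> + 1 < \<bar>x\<bar>"
      then have "x - t < 0 \<or> 1 < x - t" by linarith
      then have "c n * (x - t) < 0 \<or> 1 < c n * (x - t)"
        using c1[of n] mult_right_mono[of 1 "c n" "x - t"] by (smt (verit) mult_pos_neg)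
      then show "S n (Suc 0) x t *\<^sub>R F x = 0" using H'0 by (simp add: S1)
    qed
    have scale: "(LINT x|lebesgue. S n (Suc 0) x t *\<^sub>R F x) = (LINT u|lebesgue. h u *\<^sub>R F (t + u / c n))" for n
    proof -
      have "(LINT u|lebesgue. h u *\<^sub>R F (t + u / c n)) =
          \<bar>c n\<bar> *\<^sub>R (LINT x|lebesgue. h (- c n * t + c n * x) *\<^sub>R F (t + (- c n * t + c n * x) / c n))"
        using c1[of n] by (intro lebesgue_integral_real_affine) auto
      also have "\<dots> = (LINT x|lebesgue. \<bar>c n\<bar> *\<^sub>R (h (- c n * t + c n * x) *\<^sub>R F (t + (- c n * t + c n * x) / c n)))"
        by (rule integral_scaleR_right[symmetric])
      also have "\<dots> = (LINT x|lebesgue. S n (Suc 0) x t *\<^sub>R F x)"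
        using c1[of n] by (intro Bochner_Integration.integral_cong) (auto simp: S1 field_simps)
      finally show ?thesis by simp
    qed
    \<comment> \<open>For \<open>u\<close> in \<open>[0,1]\<close> the point
      \<open>t + u / c n\<close> stays in this interval because \<open>c n \<ge> 1\<close>; this
      gives the dominating function.\<close>
    have "bounded (F ` {t..t+1})"
      by (intro compact_imp_bounded compact_continuous_image contF compact_Icc)
    then obtain K where K: "\<forall>x\<in>{t..t+1}. norm (F x) \<le> K" by (auto simp: bounded_iff)
    have "(\<lambda>n. LINT u|lebesgue. h u *\<^sub>R F (t + u / c n)) \<longlonglongrightarrow> (LINT u|lebesgue. h u *\<^sub>R F t)"
    proof (rule integral_dominated_convergence[where w = "\<lambda>u. \<bar>h u\<bar> * K"])
      show "integrable lebesgue (\<lambda>u. \<bar>h u\<bar> * K)" using int by simp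
      show "(\<lambda>u. h u *\<^sub>R F t) \<in> borel_measurable lebesgue" using int by simp
      have "continuous_on UNIV (\<lambda>u. h u *\<^sub>R F (t + u / c n))" for n
        using c1[of n] by (intro continuous_intros cont_h continuous_on_compose2[OF contF[of UNIV]]) auto
      then show "(\<lambda>u. h u *\<^sub>R F (t + u / c n)) \<in> borel_measurable lebesgue" for n
        by (intro measurable_completion) (simp add: borel_measurable_continuous_onI)
      have "(\<lambda>n. h u *\<^sub>R F (t + u / c n)) \<longlonglongrightarrow> h u *\<^sub>R F (t + 0)" for u
      proof -
        have "(\<lambda>n. u / c n) \<longlonglongrightarrow> 0"
          unfolding c_def using tendsto_mult_right_zero[OF LIMSEQ_inverse_real_of_nat, of u]
          by (simp add: divide_inverse)
        then have "(\<lambda>n. t + u / c n) \<longlonglongrightarrow> t + 0" by (intro tendsto_intros)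
        moreover have "isCont F (t + 0)" using contF[of UNIV] by (simp add: continuous_on_eq_continuous_at)
        ultimately have "(\<lambda>n. F (t + u / c n)) \<longlonglongrightarrow> F (t + 0)" by (rule isCont_tendsto_compose[rotated])
        then show ?thesis by (intro tendsto_intros)
      qed
      then show "AE u in lebesgue. (\<lambda>n. h u *\<^sub>R F (t + u / c n)) \<longlonglongrightarrow> h u *\<^sub>R F t" by simp
      have "norm (h u *\<^sub>R F (t + u / c n)) \<le> \<bar>h u\<bar> * K" for u n
      proof (cases "u < 0 \<or> 1 < u")
        case False
        then have "0 \<le> u / c n" "u / c n \<le> 1" using c1[of n] by (auto simp: divide_le_eq_1)
        then show ?thesis using bspec[OF K, of "t + u / c n"] by (auto intro: mult_left_mono)
      qed (use H'0 in auto)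
      then show "AE u in lebesgue. norm (h u *\<^sub>R F (t + u / c n)) \<le> \<bar>h u\<bar> * K" for n by simp
    qed
    then show "(\<lambda>n. LINT x|lebesgue. S n (Suc 0) x t *\<^sub>R F x) \<longlonglongrightarrow> F t"
      using intH' int by (simp add: scale)
  qed
  \<comment> \<open>The two steps cancel to the right of both transitions, so \<open>P n 0\<close>
    is a test function; it tends to the indicator of \<open>{a<..b}\<close>.\<close>
  define P where "P n m x = S n m x a - S n m x b" for n m x
  have P: "deriv_chain (P n)" for n
    unfolding P_def by (intro deriv_chain_diff S)
  have Psupp: "P n 0 x = 0" if "\<bar>a\<bar> + \<bar>b\<bar> + 1 < \<bar>x\<bar>" for n x
  proof (cases "x < 0")
    case True
    then have "x - a \<le> 0" "x - b \<le> 0" using that by auto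
    then show ?thesis using c1[of n] by (simp add: P_def S_def H0 mult_nonneg_nonpos)
  next
    case False
    then have "1 \<le> x - a" "1 \<le> x - b" using that by auto
    then have "1 * 1 \<le> c n * (x - a)" "1 * 1 \<le> c n * (x - b)"
      using c1[of n] by (intro mult_mono; simp)+
    then show ?thesis by (simp add: P_def S_def H1)
  qed
  have test: "test_function (P n 0)" for n
    unfolding test_function_def using deriv_chain_cont_diff[OF P] Psupp by blast
  \<comment> \<open>The weak derivative tested against \<open>P n 0\<close>, after \<open>N\<close>
    integrations by parts have turned \<open>f\<close> into \<open>F\<close> and left one derivative
    on the test function. The sign \<open>(-1) ^ N\<close> cancels.\<close>
  have key: "(LINT x|lebesgue. S n (Suc 0) x a *\<^sub>R F x) - (LINT x|lebesgue. S n (Suc 0) x b *\<^sub>R F x) =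
      - (LINT x|lebesgue. P n 0 x *\<^sub>R g x)" for n
  proof -
    have "(LINT x|lebesgue. nth_deriv (Suc N) (P n 0) x *\<^sub>R f x) =
        (-1) ^ Suc N * (LINT x|lebesgue. P n 0 x *\<^sub>R g x)"
      using weak test[of n] unfolding weak_deriv_def by blast
    moreover have "(LINT x|lebesgue. nth_deriv (Suc N) (P n 0) x *\<^sub>R f x) =
        (-1) ^ N *\<^sub>R (LINT x|lebesgue. P n (Suc 0) x *\<^sub>R F x)"
      using cont_diff_iterated_parts[OF f P[of n] Psupp order_refl, where n = "Suc 0"] by (simp add: deriv_chain_nth_deriv[OF P] F_def)
    ultimately have "(-1) ^ N * (LINT x|lebesgue. P n (Suc 0) x *\<^sub>R F x) = (-1) ^ N * (- (LINT x|lebesgue. P n 0 x *\<^sub>R g x))"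
      by (simp add: scaleR_conv_of_real)
    then have "(LINT x|lebesgue. P n (Suc 0) x *\<^sub>R F x) = - (LINT x|lebesgue. P n 0 x *\<^sub>R g x)"
      by (subst (asm) mult_left_cancel) auto
    then show ?thesis using average_int by (simp add: P_def scaleR_diff_left)
  qed
  have "(\<lambda>n. LINT x|lebesgue. P n 0 x *\<^sub>R g x) \<longlonglongrightarrow> (LINT x|lebesgue. indicator {a<..b} x *\<^sub>R g x)"
  proof (rule integral_dominated_convergence[where w = "\<lambda>x. norm (g x)"])
    show "integrable lebesgue (\<lambda>x. norm (g x))" using g by simp
    have [measurable]: "g \<in> borel_measurable lebesgue" "{a<..b} \<in> sets lebesgue" using g by simp_all
    show "(\<lambda>x. indicat_real {a<..b} x *\<^sub>R g x) \<in> borel_measurable lebesgue" by measurable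
    show "(\<lambda>x. P n 0 x *\<^sub>R g x) \<in> borel_measurable lebesgue" for n
    proof -
      have "P n 0 \<in> borel_measurable lebesgue"
        using deriv_chain_continuous[OF P]
        by (intro measurable_completion) (simp add: borel_measurable_continuous_onI)
      then show ?thesis by measurable
    qed
    \<comment> \<open>At \<open>x = t\<close> every step is 0, hence the strict inequality and the
      half-open interval in the limit.\<close>
    have step: "(\<lambda>n. S n 0 x t) \<longlonglongrightarrow> (if t < x then 1 else 0)" for x t
    proof (cases "t < x")
      case True
      obtain n0 where "1 / (x - t) < real n0" using reals_Archimedean2 by blast
      then have "1 \<le> c n * (x - t)" if "n0 \<le> n" for n
      proof -
        have "1 / (x - t) \<le> c n" using \<open>1 / (x - t) < real n0\<close> that by (simp add: c_def)
        then show ?thesis using True by (simp add: divide_le_eq)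
      qed
      then show ?thesis using True
        by (intro tendsto_eventually eventually_sequentiallyI[of n0]) (simp add: S_def H1)
    next
      case False
      then have "c n * (x - t) \<le> 0" for n
        using c1[of n] by (intro mult_nonneg_nonpos) auto
      then show ?thesis using False by (simp add: S_def H0)
    qed
    have "(\<lambda>n. P n 0 x *\<^sub>R g x) \<longlonglongrightarrow> indicator {a<..b} x *\<^sub>R g x" for x
    proof -
      have "(\<lambda>n. P n 0 x *\<^sub>R g x) \<longlonglongrightarrow> ((if a < x then 1 else 0) - (if b < x then 1 else 0)) *\<^sub>R g x"
        unfolding P_def by (intro tendsto_intros step)
      also have "(if a < x then 1 else 0) - (if b < x then 1 else 0) = indicat_real {a<..b} x"
        using ab by (auto split: split_indicator)
      finally show ?thesis .
    qed
    then show "AE x in lebesgue. (\<lambda>n. P n 0 x *\<^sub>R g x) \<longlonglongrightarrow> indicator {a<..b} x *\<^sub>R g x" by simp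
    have "\<bar>P n 0 x\<bar> \<le> 1" for n x
      using H01[of "c n * (x - a)"] H01[of "c n * (x - b)"] by (auto simp: P_def S_def)
    then show "AE x in lebesgue. norm (P n 0 x *\<^sub>R g x) \<le> norm (g x)" for n
      by (simp add: mult_left_le_one_le)
  qed
  then have "(\<lambda>n. - (LINT x|lebesgue. P n 0 x *\<^sub>R g x)) \<longlonglongrightarrow> - (LINT x|lebesgue. indicator {a<..b} x *\<^sub>R g x)"
    by (rule tendsto_minus)
  moreover have "(\<lambda>n. - (LINT x|lebesgue. P n 0 x *\<^sub>R g x)) \<longlonglongrightarrow> F a - F b"
    unfolding key[symmetric] by (intro tendsto_diff average)
  ultimately have "F a - F b = - (LINT x|lebesgue. indicator {a<..b} x *\<^sub>R g x)"
    by (rule LIMSEQ_unique[rotated])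
  then show ?thesis by (simp add: F_def algebra_simps)
qed

subsection \<open>Taylor remainders and the coefficients\<close>

text \<open>The derivative of the remainder of \<open>nth_deriv (N - Suc m) f\<close> is the
  remainder of \<open>nth_deriv (N - m) f\<close>, so each use of the mean value inequality gains a
  factor \<open>\<delta>\<close>. Only the oscillation of the derivative of order \<open>N\<close>
  enters, since the next one is available only weakly.\<close>

lemma taylor_remainder_bound:
  fixes f :: "real \<Rightarrow> 'a::real_normed_vector"
  assumes f: "cont_diff N f"
    and B: "\<And>t. \<bar>t\<bar> \<le> \<delta> \<Longrightarrow> norm (nth_deriv N f (x + t) - nth_deriv N f x) \<le> B"
    and "m \<le> N" "\<bar>t\<bar> \<le> \<delta>"
  shows "norm (nth_deriv (N - m) f (x + t) - (\<Sum>l\<le>m. (t ^ l / fact l) *\<^sub>R nth_deriv (N - m + l) f x)) \<le> \<delta> ^ m * B"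
  using assms(3,4)
proof (induction m arbitrary: t)
  case 0
  then show ?case using B by simp
next
  case (Suc m)
  define n where "n = N - Suc m"
  have n: "N - m = Suc n" "n < N" using Suc.prems by (auto simp: n_def)
  define r where "r t = nth_deriv n f (x + t) - (\<Sum>l\<le>Suc m. (t ^ l / fact l) *\<^sub>R nth_deriv (n + l) f x)" for t
  define r' where "r' t = nth_deriv (Suc n) f (x + t) - (\<Sum>l\<le>m. (t ^ l / fact l) *\<^sub>R nth_deriv (Suc n + l) f x)" for t
  have \<delta>: "0 \<le> \<delta>" using Suc.prems(2) by linarith
  have IH: "norm (r' t) \<le> \<delta> ^ m * B" if "\<bar>t\<bar> \<le> \<delta>" for t
    using Suc.IH[OF _ that] Suc.prems(1) by (simp add: r'_def n)
  have dr: "(r has_vector_derivative r' t) (at t)" for t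
  proof -
    have "((nth_deriv n f \<circ> (\<lambda>t. x + t)) has_vector_derivative 1 *\<^sub>R nth_deriv (Suc n) f (x + t)) (at t)"
      using cont_diff_has_vector_derivative[OF f n(2)]
      by (intro vector_diff_chain_at) (auto intro!: derivative_eq_intros)
    then have 1: "((\<lambda>t. nth_deriv n f (x + t)) has_vector_derivative nth_deriv (Suc n) f (x + t)) (at t)"
      by (simp add: o_def)
    have "((\<lambda>t. t ^ Suc l / fact (Suc l)) has_real_derivative t ^ l / fact l) (at t)" for l
    proof -
      have "((\<lambda>t. t ^ Suc l / fact (Suc l)) has_real_derivative (real (Suc l) * t ^ l) / fact (Suc l)) (at t)"
        by (intro DERIV_cdivide) (rule DERIV_pow[of "Suc l", simplified diff_Suc_Suc minus_nat.diff_0])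
      also have "(real (Suc l) * t ^ l) / fact (Suc l) = t ^ l / fact l"
        by (simp del: of_nat_Suc)
      finally show ?thesis .
    qed
    then have "((\<lambda>t. (t ^ Suc l / fact (Suc l)) *\<^sub>R nth_deriv (n + Suc l) f x) has_vector_derivative
        (t ^ l / fact l) *\<^sub>R nth_deriv (n + Suc l) f x) (at t)" for l
      using has_vector_derivative_scaleR[OF _ has_vector_derivative_const] by fastforce
    then have "((\<lambda>t. \<Sum>l\<le>m. (t ^ Suc l / fact (Suc l)) *\<^sub>R nth_deriv (n + Suc l) f x) has_vector_derivative
        (\<Sum>l\<le>m. (t ^ l / fact l) *\<^sub>R nth_deriv (n + Suc l) f x)) (at t)"
      by (intro has_vector_derivative_sum)
    then have "((\<lambda>t. nth_deriv n f x + (\<Sum>l\<le>m. (t ^ Suc l / fact (Suc l)) *\<^sub>R nth_deriv (n + Suc l) f x)) has_vector_derivative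
        (0 + (\<Sum>l\<le>m. (t ^ l / fact l) *\<^sub>R nth_deriv (n + Suc l) f x))) (at t)"
      by (intro has_vector_derivative_add has_vector_derivative_const)
    \<comment> \<open>Splitting off the constant term \<open>l = 0\<close> aligns the remaining
      terms of \<open>r\<close> with those of \<open>r'\<close>.\<close>
    from has_vector_derivative_diff[OF 1 this] show ?thesis
      unfolding r_def r'_def sum.atMost_Suc_shift by simp
  qed
  have "norm (r t - r 0) \<le> (\<delta> ^ m * B) * norm (t - 0)"
  proof (rule differentiable_bound)
    show "convex {-\<delta>..\<delta>}" by simp
    fix s assume s: "s \<in> {-\<delta>..\<delta>}"
    show "(r has_derivative (\<lambda>h. h *\<^sub>R r' s)) (at s within {-\<delta>..\<delta>})"
      using dr[of s] unfolding has_vector_derivative_def by (rule has_derivative_at_withinI)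
    show "onorm (\<lambda>h. h *\<^sub>R r' s) \<le> \<delta> ^ m * B"
      using IH[of s] s by (intro onorm_le) (auto simp: mult.commute intro: mult_left_mono)
  qed (use Suc.prems \<delta> in auto)
  moreover have "r 0 = 0" unfolding r_def sum.atMost_Suc_shift by simp
  ultimately have "norm (r t) \<le> (\<delta> ^ m * B) * \<bar>t\<bar>" by simp
  \<comment> \<open>The factor \<open>\<delta> ^ m * B\<close> is nonnegative because
    \<open>IH\<close> at 0 bounds a norm by it.\<close>
  also have "\<dots> \<le> (\<delta> ^ m * B) * \<delta>"
    using Suc.prems(2) IH[of 0] \<delta> by (intro mult_left_mono) (auto intro: order.trans[OF norm_ge_zero])
  finally show ?case by (simp add: r_def n_def mult_ac)
qed

lemma integral_power_symmetric:
  assumes "0 \<le> (\<delta>::real)"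
  shows "integral {-\<delta>..\<delta>} (\<lambda>t. t ^ l) = (\<delta> ^ Suc l - (- \<delta>) ^ Suc l) / real (Suc l)"
proof -
  have "((\<lambda>t. t ^ l) has_integral \<delta> ^ Suc l / real (Suc l) - (- \<delta>) ^ Suc l / real (Suc l)) {-\<delta>..\<delta>}"
  proof (rule fundamental_theorem_of_calculus)
    fix x :: real
    have "((\<lambda>t. t ^ Suc l / real (Suc l)) has_real_derivative (real (Suc l) * x ^ l) / real (Suc l)) (at x within {-\<delta>..\<delta>})"
      by (intro DERIV_cdivide) (rule DERIV_pow[of "Suc l", simplified diff_Suc_Suc minus_nat.diff_0])
    then show "((\<lambda>t. t ^ Suc l / real (Suc l)) has_vector_derivative x ^ l) (at x within {-\<delta>..\<delta>})"
      by (simp add: has_real_derivative_iff_has_vector_derivative del: of_nat_Suc)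
  qed (use assms in simp)
  then show ?thesis by (subst diff_divide_distrib) (rule integral_unique)
qed

text \<open>The moment of order \<open>l\<close> is homogeneous of degree \<open>l + 1\<close> in
  the radius. One power cancels against the normalisation; the others become the factor that the
  chain rule produces in \<open>diff_op_dilation\<close>.\<close>

lemma diff_op_coeff_scaled:
  assumes "0 < h" "0 < m"
  shows "(m / (2 * h)) * (integral {-(h / m)..h / m} (\<lambda>t. t ^ l) / fact l) = diff_op_coeff h l * (1 / m) ^ l"
proof -
  have "m * ((h / m) ^ Suc l - (- (h / m)) ^ Suc l) = (h ^ Suc l - (- h) ^ Suc l) * (1 / m) ^ l"
    using assms by (simp add: power_divide power_minus' field_simps)
  then show ?thesis
    using assms by (simp add: diff_op_coeff_def integral_power_symmetric del: power_Suc of_nat_Suc)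
qed

lemma diff_op_dilation:
  assumes f: "cont_diff N f" and m: "m \<noteq> 0"
  shows "diff_op h N (\<lambda>x. f (x / m)) y = (\<Sum>l\<le>N. (diff_op_coeff h l * (1 / m) ^ l) *\<^sub>R nth_deriv l f (y / m))"
proof -
  define D where "D l x = (1 / m) ^ l *\<^sub>R nth_deriv l f (x / m)" for l x
  have "nth_deriv l (D 0) = D l" if "l \<le> N" for l
  proof (rule nth_deriv_eq[OF _ that])
    fix l x assume "l < N"
    have "((nth_deriv l f \<circ> (\<lambda>x. x / m)) has_vector_derivative (1 / m) *\<^sub>R nth_deriv (Suc l) f (x / m)) (at x)"
      using cont_diff_has_vector_derivative[OF f \<open>l < N\<close>] m
      by (intro vector_diff_chain_at)
         (auto intro!: derivative_eq_intros simp flip: has_real_derivative_iff_has_vector_derivative)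
    then have "((\<lambda>x. (1 / m) ^ l *\<^sub>R nth_deriv l f (x / m)) has_vector_derivative
        (1 / m) ^ l *\<^sub>R ((1 / m) *\<^sub>R nth_deriv (Suc l) f (x / m))) (at x)"
      by (intro bounded_linear.has_vector_derivative[OF bounded_linear_scaleR_right]) (simp add: o_def)
    then show "(D l has_vector_derivative D (Suc l) x) (at x)"
      by (simp add: D_def[abs_def] mult.commute)
  qed
  moreover have "D 0 = (\<lambda>x. f (x / m))" by (simp add: D_def nth_deriv_def fun_eq_iff)
  ultimately show ?thesis
    by (simp add: diff_op_def D_def atLeast0AtMost)
qed

text \<open>The mean over \<open>[-\<delta>, \<delta>]\<close> of the Taylor polynomial
  \<open>T\<close> at \<open>x\<close> is exactly the value of the operator, so the coefficient is
  the mean of the Taylor remainder.\<close>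

lemma norm_eps_coeff_le:
  fixes f :: "real \<Rightarrow> complex" and M k :: int
  assumes f: "cont_diff N f" and h: "0 < h" and M: "0 < M"
    and B: "\<And>t. \<bar>t\<bar> \<le> h / of_int M ^ j \<Longrightarrow>
      norm (nth_deriv N f (of_int k / of_int M ^ j + t) - nth_deriv N f (of_int k / of_int M ^ j)) \<le> B"
  shows "norm (eps_coeff h N M f j k) \<le> (h / of_int M ^ j) ^ N * B"
proof -
  define m where "m = (of_int M :: real) ^ j"
  have m: "0 < m" using M by (simp add: m_def)
  define \<delta> where "\<delta> = h / m"
  have \<delta>: "0 < \<delta>" using h m by (simp add: \<delta>_def)
  define x where "x = of_int k / m"
  define T where "T t = (\<Sum>l\<le>N. (t ^ l / fact l) *\<^sub>R nth_deriv l f x)" for t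
  have contf: "continuous_on A (\<lambda>t. f (x + t))" for A
  proof -
    have "continuous_on UNIV (nth_deriv 0 f)" using f by (simp add: cont_diff_def)
    then have "continuous_on UNIV f" by (simp add: nth_deriv_def)
    then show ?thesis
      by (rule continuous_on_compose2) (auto intro!: continuous_intros)
  qed
  have contT: "continuous_on A T" for A
    unfolding T_def
    by (intro continuous_on_sum continuous_on_scaleR continuous_on_divide continuous_on_power
        continuous_on_id continuous_on_const) auto
  have "diff_op h N (\<lambda>x. f (x / m)) (of_int k) =
      (\<Sum>l\<le>N. (diff_op_coeff h l * (1 / m) ^ l) *\<^sub>R nth_deriv l f x)"
    using diff_op_dilation[OF f, of m h "of_int k"] m unfolding x_def by simp
  also have "\<dots> = (m / (2 * h)) *\<^sub>R (\<Sum>l\<le>N. (integral {-\<delta>..\<delta>} (\<lambda>t. t ^ l) / fact l) *\<^sub>R nth_deriv l f x)"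
    by (simp add: scaleR_sum_right diff_op_coeff_scaled[OF h m, symmetric] \<delta>_def)
  also have "(\<Sum>l\<le>N. (integral {-\<delta>..\<delta>} (\<lambda>t. t ^ l) / fact l) *\<^sub>R nth_deriv l f x) = integral {-\<delta>..\<delta>} T"
  proof -
    have "((\<lambda>t. (t ^ l / fact l) *\<^sub>R nth_deriv l f x) has_integral
        (integral {-\<delta>..\<delta>} (\<lambda>t. t ^ l) / fact l) *\<^sub>R nth_deriv l f x) {-\<delta>..\<delta>}" for l
      by (intro has_integral_scaleR_left has_integral_divide integrable_integral
          integrable_continuous_real continuous_on_power continuous_on_id)
    then have "(T has_integral (\<Sum>l\<le>N. (integral {-\<delta>..\<delta>} (\<lambda>t. t ^ l) / fact l) *\<^sub>R nth_deriv l f x)) {-\<delta>..\<delta>}"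
      unfolding T_def by (intro has_integral_sum) auto
    then show ?thesis by (simp add: integral_unique)
  qed
  finally have "eps_coeff h N M f j k =
      (m / (2 * h)) *\<^sub>R (integral {-\<delta>..\<delta>} (\<lambda>t. f (x + t)) - integral {-\<delta>..\<delta>} T)"
    by (simp add: eps_coeff_def m_def x_def \<delta>_def scaleR_diff_right)
  also have "integral {-\<delta>..\<delta>} (\<lambda>t. f (x + t)) - integral {-\<delta>..\<delta>} T = integral {-\<delta>..\<delta>} (\<lambda>t. f (x + t) - T t)"
    by (intro integral_diff[symmetric] integrable_continuous_real contf contT)
  finally have "norm (eps_coeff h N M f j k) = (m / (2 * h)) * norm (integral {-\<delta>..\<delta>} (\<lambda>t. f (x + t) - T t))"
    using h m by simp
  \<comment> \<open>The interval has length \<open>2 * h / m\<close>, which the prefactor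
    cancels.\<close>
  also have "\<dots> \<le> (m / (2 * h)) * ((\<delta> ^ N * B) * (\<delta> - (- \<delta>)))"
  proof (intro mult_left_mono integral_bound continuous_on_diff contf contT)
    fix t assume "t \<in> {-\<delta>..\<delta>}"
    then show "norm (f (x + t) - T t) \<le> \<delta> ^ N * B"
      using taylor_remainder_bound[OF f, of \<delta> x B N t] B
      by (auto simp: T_def x_def \<delta>_def m_def nth_deriv_def)
  qed (use h m \<delta> in auto)
  also have "\<dots> = \<delta> ^ N * B" using h m by (simp add: \<delta>_def)
  finally show ?thesis by (simp add: \<delta>_def m_def)
qed

section \<open>Finite overlap of the intervals and summability of the coefficients\<close>

lemma card_int_interval_le:
  fixes y h :: real
  assumes "0 \<le> h"
  shows "finite {k::int. \<bar>y + of_int k\<bar> \<le> h} \<and> real (card {k::int. \<bar>y + of_int k\<bar> \<le> h}) \<le> 2 * h + 1"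
proof -
  have "{k::int. \<bar>y + of_int k\<bar> \<le> h} = {\<lceil>- y - h\<rceil>..\<lfloor>h - y\<rfloor>}"
    by (auto simp: abs_le_iff ceiling_le_iff le_floor_iff)
  moreover have "real (card {\<lceil>- y - h\<rceil>..\<lfloor>h - y\<rfloor>}) \<le> 2 * h + 1"
    using assms by simp linarith
  ultimately show ?thesis by simp
qed

text \<open>By Tonelli, the sum is the integral of \<open>norm (g x)\<close> times the number of
  intervals of radius \<open>h / m\<close> around the points \<open>- k / m\<close> that contain
  \<open>x\<close>. That number is at most \<open>2 * h + 1\<close> for every \<open>m\<close>,
  which is why the final constant does not depend on \<open>j\<close>.\<close>

lemma summable_local_integrals:
  fixes g :: "real \<Rightarrow> 'a::{banach, second_countable_topology}" and h m :: real
  assumes g: "integrable lebesgue g" and h: "0 \<le> h" and m: "0 < m"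
  defines "B \<equiv> \<lambda>k::int. LINT x|lebesgue. indicator {x. \<bar>m * x + of_int k\<bar> \<le> h} x * norm (g x)"
  shows "integrable (count_space UNIV) B \<and>
    (LINT k|count_space UNIV. B k) \<le> (2 * h + 1) * (LINT x|lebesgue. norm (g x))"
proof -
  have [measurable]: "g \<in> borel_measurable lebesgue" using g by simp
  have closed: "closed {x. \<bar>m * x + of_int k\<bar> \<le> h}" for k :: int
    by (intro closed_Collect_le continuous_intros)
  then have sets[measurable]: "{x. \<bar>m * x + of_int k\<bar> \<le> h} \<in> sets lebesgue" for k :: int
    by (simp add: borel_closed)
  have B0: "0 \<le> B k" for k unfolding B_def by (intro integral_nonneg_AE) auto
  have ng: "integrable lebesgue (\<lambda>x. norm (g x))" using g by simp
  have "integrable lebesgue (\<lambda>x. indicator {x. \<bar>m * x + of_int k\<bar> \<le> h} x * norm (g x))" for k :: int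
    using ng by (rule Bochner_Integration.integrable_bound) (auto split: split_indicator)
  then have "ennreal (B k) = (\<integral>\<^sup>+x. ennreal (indicator {x. \<bar>m * x + of_int k\<bar> \<le> h} x * norm (g x)) \<partial>lebesgue)" for k
    unfolding B_def by (intro nn_integral_eq_integral[symmetric]) auto
  then have "(\<integral>\<^sup>+k. ennreal (B k) \<partial>count_space UNIV) =
      (\<integral>\<^sup>+k. \<integral>\<^sup>+x. ennreal (indicator {x. \<bar>m * x + of_int k\<bar> \<le> h} x * norm (g x)) \<partial>lebesgue \<partial>count_space (UNIV :: int set))"
    by simp
  also have "\<dots> = (\<integral>\<^sup>+x. \<integral>\<^sup>+k. ennreal (indicator {x. \<bar>m * x + of_int k\<bar> \<le> h} x * norm (g x)) \<partial>count_space (UNIV :: int set) \<partial>lebesgue)"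
    by (intro nn_integral_count_space_nn_integral[symmetric]) auto
  also have "\<dots> \<le> (\<integral>\<^sup>+x. ennreal (2 * h + 1) * ennreal (norm (g x)) \<partial>lebesgue)"
  proof (rule nn_integral_mono)
    fix x
    let ?K = "{k::int. \<bar>m * x + of_int k\<bar> \<le> h}"
    have "(\<integral>\<^sup>+k. ennreal (indicator {x. \<bar>m * x + of_int k\<bar> \<le> h} x * norm (g x)) \<partial>count_space (UNIV :: int set))
        = (\<integral>\<^sup>+k. indicator ?K k * ennreal (norm (g x)) \<partial>count_space UNIV)"
      by (intro nn_integral_cong) (auto split: split_indicator)
    also have "\<dots> = emeasure (count_space UNIV) ?K * ennreal (norm (g x))"
      by (subst nn_integral_multc) auto
    also have "\<dots> \<le> ennreal (2 * h + 1) * ennreal (norm (g x))"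
      using card_int_interval_le[OF h, of "m * x"]
      by (intro mult_right_mono) (auto simp: emeasure_count_space_finite ennreal_of_nat_eq_real_of_nat intro: ennreal_leI)
    finally show "(\<integral>\<^sup>+k. ennreal (indicator {x. \<bar>m * x + of_int k\<bar> \<le> h} x * norm (g x)) \<partial>count_space (UNIV :: int set))
        \<le> ennreal (2 * h + 1) * ennreal (norm (g x))" .
  qed
  also have "\<dots> = ennreal ((2 * h + 1) * (LINT x|lebesgue. norm (g x)))"
    using ng h by (simp add: nn_integral_cmult nn_integral_eq_integral ennreal_mult integral_nonneg_AE)
  finally have le: "(\<integral>\<^sup>+k. ennreal (B k) \<partial>count_space UNIV) \<le> ennreal ((2 * h + 1) * (LINT x|lebesgue. norm (g x)))" .
  then have int: "integrable (count_space UNIV) B"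
    using B0 by (simp add: integrable_iff_bounded le_less_trans[OF _ ennreal_less_top])
  moreover have "ennreal (LINT k|count_space UNIV. B k) \<le> ennreal ((2 * h + 1) * (LINT x|lebesgue. norm (g x)))"
    using le int B0 by (simp add: nn_integral_eq_integral)
  then have "(LINT k|count_space UNIV. B k) \<le> (2 * h + 1) * (LINT x|lebesgue. norm (g x))"
    using h by (simp add: ennreal_le_iff integral_nonneg_AE)
  ultimately show ?thesis by simp
qed

text \<open>The oscillation bound required by \<open>norm_eps_coeff_le\<close> is the local integral
  of \<open>norm (g x)\<close> around \<open>- k / m\<close>; summing these uses the overlap
  bound.\<close>

lemma summable_eps_coeff:
  fixes f g :: "real \<Rightarrow> complex" and M :: int
  assumes f: "cont_diff N f" and g: "integrable lebesgue g" and weak: "weak_deriv (Suc N) f g"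
    and h: "0 < h" and M: "0 < M"
  shows "integrable (count_space UNIV) (\<lambda>k. eps_coeff h N M f j (- k)) \<and>
    (LINT k|count_space UNIV. norm (eps_coeff h N M f j (- k)))
      \<le> (h / of_int M ^ j) ^ N * ((2 * h + 1) * (LINT x|lebesgue. norm (g x)))"
proof -
  define m where "m = (of_int M :: real) ^ j"
  have m: "0 < m" using M by (simp add: m_def)
  define B where "B k = (LINT x|lebesgue. indicator {x. \<bar>m * x + of_int k\<bar> \<le> h} x * norm (g x))" for k :: int
  have sum: "integrable (count_space UNIV) B"
    "(LINT k|count_space UNIV. B k) \<le> (2 * h + 1) * (LINT x|lebesgue. norm (g x))"
    using summable_local_integrals[OF g _ m, of h] h by (auto simp: B_def[abs_def])
  have ng: "integrable lebesgue (\<lambda>x. norm (g x))" using g by simp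
  have [measurable]: "g \<in> borel_measurable lebesgue" using g by simp
  have bound: "norm (eps_coeff h N M f j (- k)) \<le> (h / m) ^ N * B k" for k
    unfolding m_def
  proof (rule norm_eps_coeff_le[OF f h M], fold m_def)
    fix t assume t: "\<bar>t\<bar> \<le> h / m"
    let ?y = "of_int (- k) / m"
    \<comment> \<open>Stated for ordered end points; negative \<open>t\<close> is treated below by
      exchanging them.\<close>
    have *: "norm (nth_deriv N f b - nth_deriv N f a) \<le> B k"
      if "a \<le> b" and sub: "{a<..b} \<subseteq> {x. \<bar>m * x + of_int k\<bar> \<le> h}" for a b
    proof -
      have "closed {x. \<bar>m * x + of_int k\<bar> \<le> h}"
        by (intro closed_Collect_le continuous_intros)
      then have [measurable]: "{x. \<bar>m * x + of_int k\<bar> \<le> h} \<in> sets lebesgue"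
        by (simp add: borel_closed)
      have "norm (nth_deriv N f b - nth_deriv N f a) \<le> (LINT x|lebesgue. norm (indicat_real {a<..b} x *\<^sub>R g x))"
        unfolding weak_deriv_fundamental_theorem[OF f g weak that(1)] by (rule integral_norm_bound)
      also have "\<dots> \<le> B k"
        unfolding B_def
      proof (rule integral_mono_AE)
        show "integrable lebesgue (\<lambda>x. norm (indicat_real {a<..b} x *\<^sub>R g x))"
        proof (rule Bochner_Integration.integrable_bound[OF ng])
          have [measurable]: "{a<..b} \<in> sets lebesgue" by simp
          show "(\<lambda>x. norm (indicat_real {a<..b} x *\<^sub>R g x)) \<in> borel_measurable lebesgue" by measurable
        qed (auto split: split_indicator)
        show "integrable lebesgue (\<lambda>x. indicator {x. \<bar>m * x + of_int k\<bar> \<le> h} x * norm (g x))"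
          using ng by (rule Bochner_Integration.integrable_bound) (auto split: split_indicator)
        have "norm (indicat_real {a<..b} x *\<^sub>R g x) \<le> indicator {x. \<bar>m * x + of_int k\<bar> \<le> h} x * norm (g x)" for x
          using subsetD[OF sub, of x] by (auto split: split_indicator)
        then show "AE x in lebesgue. norm (indicat_real {a<..b} x *\<^sub>R g x) \<le>
            indicator {x. \<bar>m * x + of_int k\<bar> \<le> h} x * norm (g x)" by simp
      qed
      finally show ?thesis .
    qed
    have in_h: "\<bar>m * x + of_int k\<bar> \<le> h" if "\<bar>x - ?y\<bar> \<le> h / m" for x
    proof -
      have "m * x + of_int k = m * (x - ?y)" using m by (simp add: field_simps)
      then have "\<bar>m * x + of_int k\<bar> = m * \<bar>x - ?y\<bar>" using m by (simp add: abs_mult)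
      also have "\<dots> \<le> m * (h / m)" using that m by (intro mult_left_mono) auto
      finally show ?thesis using m by simp
    qed
    show "norm (nth_deriv N f (?y + t) - nth_deriv N f ?y) \<le> B k"
    proof (cases "0 \<le> t")
      case True
      then show ?thesis using t in_h by (intro *) auto
    next
      case False
      then have "norm (nth_deriv N f ?y - nth_deriv N f (?y + t)) \<le> B k"
        using t in_h by (intro *) auto
      then show ?thesis by (simp add: norm_minus_commute)
    qed
  qed
  have int: "integrable (count_space UNIV) (\<lambda>k. (h / m) ^ N * B k)" using sum(1) by simp
  have eps: "integrable (count_space UNIV) (\<lambda>k. eps_coeff h N M f j (- k))"
    using int by (rule Bochner_Integration.integrable_bound) (use bound order.trans[OF _ abs_ge_self] in auto)
  then have "(LINT k|count_space UNIV. norm (eps_coeff h N M f j (- k))) \<le> (LINT k|count_space UNIV. (h / m) ^ N * B k)"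
    using int bound by (intro integral_mono) auto
  also have "\<dots> = (h / m) ^ N * (LINT k|count_space UNIV. B k)" by simp
  also have "\<dots> \<le> (h / m) ^ N * ((2 * h + 1) * (LINT x|lebesgue. norm (g x)))"
    using sum(2) h m by (intro mult_left_mono) auto
  finally show ?thesis using eps by (simp add: m_def)
qed

subsection \<open>Series in Lebesgue spaces\<close>

text \<open>Convexity of the power function on the open half-line, where the tangent exists; the end
  point \<open>u = 0\<close> is checked directly.\<close>

lemma powr_above_tangent:
  fixes t u p :: real
  assumes "1 \<le> p" "0 < t" "0 \<le> u"
  shows "t powr p + p * t powr (p - 1) * (u - t) \<le> u powr p"
proof (cases "u = 0")
  case True
  have "t powr p = t * t powr (p - 1)"
    using assms by (simp add: powr_mult_base)
  moreover have "t * t powr (p - 1) \<le> p * (t * t powr (p - 1))"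
    using assms by (intro mult_le_cancel_right1[THEN iffD2] impI conjI) (auto simp: not_less mult_less_0_iff)
  ultimately show ?thesis using True by (simp add: algebra_simps)
next
  case False
  have "u powr p - t powr p \<ge> (p * t powr (p - 1)) * (u - t)"
  proof (rule convex_on_imp_above_tangent[where A = "{0<..}"])
    show "convex_on {0<..} (\<lambda>x. x powr p)"
      using assms(1) by (rule powr_convex)
    show "((\<lambda>x. x powr p) has_field_derivative p * t powr (p - 1)) (at t within {0<..})"
      using assms by (auto intro!: derivative_eq_intros)
  qed (use assms False in \<open>auto simp: interior_open\<close>)
  then show ?thesis by simp
qed

text \<open>Jensen's inequality for weights that need not have mass one, hence the factor with
  exponent \<open>p - 1\<close>. It follows by integrating the tangent inequality at the weighted
  mean.\<close>

lemma weighted_Jensen_powr: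
  fixes w u :: "'a \<Rightarrow> real"
  assumes p: "1 \<le> p" and w: "integrable M w" "\<And>x. 0 \<le> w x"
    and u: "u \<in> borel_measurable M" "\<And>x. 0 \<le> u x"
    and wu: "integrable M (\<lambda>x. w x * u x powr p)"
  shows "integrable M (\<lambda>x. w x * u x)"
    and "(LINT x|M. w x * u x) powr p
      \<le> (LINT x|M. w x) powr (p - 1) * (LINT x|M. w x * u x powr p)"
proof -
  \<comment> \<open>Gives \<open>w x + w x * u x powr p\<close> as an integrable majorant of
    \<open>w x * u x\<close>.\<close>
  have le: "y \<le> 1 + y powr p" if "0 \<le> y" for y :: real
  proof (cases "y \<le> 1")
    case False
    then have "y powr 1 \<le> y powr p" using p by (intro powr_mono) auto
    with that show ?thesis by simp
  qed (simp add: add_increasing2)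
  show int: "integrable M (\<lambda>x. w x * u x)"
  proof (rule Bochner_Integration.integrable_bound)
    show "integrable M (\<lambda>x. w x + w x * u x powr p)"
      using w wu by simp
    show "(\<lambda>x. w x * u x) \<in> borel_measurable M"
      using w u by measurable
    have "w x * u x \<le> w x * (1 + u x powr p)" for x
      using w u le by (intro mult_left_mono) auto
    then show "AE x in M. norm (w x * u x) \<le> norm (w x + w x * u x powr p)"
      using w u by (auto simp: algebra_simps)
  qed
  define A where "A = (LINT x|M. w x)"
  define I where "I = (LINT x|M. w x * u x)"
  have A0: "0 \<le> A" and I0: "0 \<le> I"
    using w u unfolding A_def I_def by (auto intro!: integral_nonneg_AE)
  have J0: "0 \<le> (LINT x|M. w x * u x powr p)"
    using w u by (auto intro!: integral_nonneg_AE)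
  show "I powr p \<le> A powr (p - 1) * (LINT x|M. w x * u x powr p)"
  \<comment> \<open>The tangent is taken at \<open>I / A\<close>, which must be positive.\<close>
  proof (cases "I = 0")
    case True
    then show ?thesis using J0 by (simp add: True)
  next
    case False
    then have Ipos: "0 < I" using I0 by simp
    have "A \<noteq> 0"
    proof
      assume "A = 0"
      then have "AE x in M. w x = 0"
        using integral_nonneg_eq_0_iff_AE[OF w(1)] w(2) unfolding A_def by auto
      then have "AE x in M. w x * u x = 0" by auto
      then have "I = 0" unfolding I_def by (rule integral_eq_zero_AE)
      with False show False by simp
    qed
    then have Apos: "0 < A" using A0 by simp
    define t where "t = I / A"
    have t: "0 < t" using Apos Ipos by (simp add: t_def)
    have "(LINT x|M. w x * (t powr p + p * t powr (p - 1) * (u x - t)))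
        \<le> (LINT x|M. w x * u x powr p)"
    proof (rule integral_mono)
      show "integrable M (\<lambda>x. w x * (t powr p + p * t powr (p - 1) * (u x - t)))"
      proof -
        have "integrable M (\<lambda>x. (t powr p - p * t powr (p - 1) * t) * w x + (p * t powr (p - 1)) * (w x * u x))"
          using w int by simp
        then show ?thesis by (simp add: algebra_simps)
      qed
    qed (use wu w u powr_above_tangent[OF p t] in \<open>auto intro: mult_left_mono\<close>)
    also have "(LINT x|M. w x * (t powr p + p * t powr (p - 1) * (u x - t))) =
        (LINT x|M. (t powr p - p * t powr (p - 1) * t) * w x + (p * t powr (p - 1)) * (w x * u x))"
      by (simp add: algebra_simps)
    also have "\<dots> = (t powr p - p * t powr (p - 1) * t) * A + (p * t powr (p - 1)) * I"
      using w int by (simp add: A_def I_def)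
    \<comment> \<open>Since \<open>A * t = I\<close>, the linear part of the tangent integrates to
      zero.\<close>
    also have "\<dots> = A * t powr p"
      using Apos by (simp add: t_def algebra_simps)
    finally have "A powr (p - 1) * (A * t powr p)
        \<le> A powr (p - 1) * (LINT x|M. w x * u x powr p)"
      by (intro mult_left_mono) auto
    moreover have "A powr (p - 1) * (A * t powr p) = I powr p"
    proof -
      have "A powr (p - 1) * A = A powr p"
        using Apos by (simp add: powr_mult_base mult.commute)
      then have "A powr (p - 1) * (A * t powr p) = A powr p * t powr p" by simp
      also have "\<dots> = (A * t) powr p" using Apos t by (simp add: powr_mult)
      finally show ?thesis using Apos by (simp add: t_def)
    qed
    ultimately show ?thesis by simp
  qed
qed

text \<open>Membership and norm bound become one inequality of extended nonnegative integrals, where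
  Tonelli and substitution apply without prior integrability.\<close>

lemma Lp_le_iff_finite:
  fixes f :: "real \<Rightarrow> 'a::real_normed_vector"
  assumes "1 \<le> p" "0 \<le> B" and f[measurable]: "f \<in> borel_measurable lebesgue"
  shows "in_Lp (ereal p) f \<and> Lp_norm (ereal p) f \<le> B \<longleftrightarrow>
    (\<integral>\<^sup>+x. ennreal (norm (f x) powr p) \<partial>lebesgue) \<le> ennreal (B powr p)"
proof -
  let ?I = "LINT x|lebesgue. norm (f x) powr p"
  have I0: "0 \<le> ?I" by (simp add: integral_nonneg_AE)
  have *: "?I powr (1 / p) \<le> B \<longleftrightarrow> ?I \<le> B powr p"
  proof -
    have "(?I powr (1 / p)) powr p = ?I" "(B powr p) powr (1 / p) = B"
      using assms I0 by (simp_all add: powr_powr)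
    then show ?thesis
      using assms I0 powr_mono2[of p "?I powr (1 / p)" B] powr_mono2[of "1 / p" ?I "B powr p"]
      by auto
  qed
  show ?thesis
  proof (cases "integrable lebesgue (\<lambda>x. norm (f x) powr p)")
    case True
    then have "(\<integral>\<^sup>+x. ennreal (norm (f x) powr p) \<partial>lebesgue) = ennreal ?I"
      by (intro nn_integral_eq_integral) auto
    with True show ?thesis using assms * by (simp add: in_Lp_def Lp_norm_def)
  next
    case False
    then have "(\<integral>\<^sup>+x. ennreal (norm (f x) powr p) \<partial>lebesgue) = \<infinity>"
      by (simp add: integrable_iff_bounded less_top flip: top.not_eq_extremum)
    then show ?thesis using False assms by (simp add: in_Lp_def top_unique)
  qed
qed

lemma Lp_le_iff_infinity:
  fixes f :: "real \<Rightarrow> 'a::real_normed_vector"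
  assumes "0 \<le> B" and f[measurable]: "f \<in> borel_measurable lebesgue"
  shows "in_Lp \<infinity> f \<and> Lp_norm \<infinity> f \<le> B \<longleftrightarrow> (AE x in lebesgue. norm (f x) \<le> B)"
proof -
  let ?e = "esssup lebesgue (\<lambda>x. ereal (norm (f x)))"
  \<comment> \<open>Excludes the value minus infinity, which \<open>real_of_ereal\<close> would send
    to 0.\<close>
  have "esssup lebesgue (\<lambda>x::real. 0 :: ereal) \<le> ?e"
    by (intro esssup_mono) auto
  then have e0: "0 \<le> ?e" by (simp add: esssup_const)
  have "in_Lp \<infinity> f \<and> Lp_norm \<infinity> f \<le> B \<longleftrightarrow> ?e \<le> ereal B"
    using e0 by (cases ?e) (auto simp: in_Lp_def Lp_norm_def)
  also have "\<dots> \<longleftrightarrow> (AE x in lebesgue. norm (f x) \<le> B)"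
  proof
    assume "?e \<le> ereal B"
    with esssup_AE[of "\<lambda>x. ereal (norm (f x))" lebesgue]
    show "AE x in lebesgue. norm (f x) \<le> B"
      by (auto elim!: eventually_mono intro: order_trans simp flip: ereal_less_eq(3))
  qed (intro esssup_I; simp)
  finally show ?thesis .
qed

lemma Lp_norm_nonneg:
  fixes f :: "real \<Rightarrow> 'a::real_normed_vector"
  assumes "in_Lp p f"
  shows "0 \<le> Lp_norm p f"
proof (cases "p = \<infinity>")
  case True
  have [measurable]: "f \<in> borel_measurable lebesgue" using assms by (simp add: in_Lp_def)
  have "esssup lebesgue (\<lambda>x::real. 0 :: ereal) \<le> esssup lebesgue (\<lambda>x. ereal (norm (f x)))"
    by (intro esssup_mono) auto
  then show ?thesis using True by (simp add: Lp_norm_def esssup_const real_of_ereal_pos)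
qed (simp add: Lp_norm_def)


text \<open>Comparing norms instead of values makes a change of sign harmless when tails of series
  are estimated.\<close>

lemma Lp_norm_cong_AE:
  fixes f g :: "real \<Rightarrow> 'a::real_normed_vector"
  assumes [measurable]: "f \<in> borel_measurable lebesgue" "g \<in> borel_measurable lebesgue"
    and eq: "AE x in lebesgue. norm (f x) = norm (g x)"
  shows "Lp_norm p f = Lp_norm p g"
proof -
  have "esssup lebesgue (\<lambda>x. ereal (norm (f x))) = esssup lebesgue (\<lambda>x. ereal (norm (g x)))"
    using eq by (intro esssup_AE_cong) auto
  moreover have "(LINT x|lebesgue. norm (f x) powr real_of_ereal p) =
      (LINT x|lebesgue. norm (g x) powr real_of_ereal p)"
    using eq by (intro integral_cong_AE) auto
  ultimately show ?thesis by (simp add: Lp_norm_def)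
qed

lemma Lp_scaleR:
  fixes f :: "real \<Rightarrow> 'a::real_normed_vector"
  assumes p: "1 \<le> p" and f: "in_Lp p f"
  shows "in_Lp p (\<lambda>x. a *\<^sub>R f x) \<and> Lp_norm p (\<lambda>x. a *\<^sub>R f x) \<le> \<bar>a\<bar> * Lp_norm p f"
proof -
  have [measurable]: "f \<in> borel_measurable lebesgue" using f by (simp add: in_Lp_def)
  have L0: "0 \<le> Lp_norm p f" using f by (rule Lp_norm_nonneg)
  show ?thesis
  proof (cases p)
    case (real r)
    then have r: "1 \<le> r" using p by simp
    have le: "(\<integral>\<^sup>+x. ennreal (norm (f x) powr r) \<partial>lebesgue) \<le> ennreal (Lp_norm p f powr r)"
      using Lp_le_iff_finite[OF r L0, of f] f real by simp
    have "(\<integral>\<^sup>+x. ennreal (norm (a *\<^sub>R f x) powr r) \<partial>lebesgue) =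
        ennreal (\<bar>a\<bar> powr r) * (\<integral>\<^sup>+x. ennreal (norm (f x) powr r) \<partial>lebesgue)"
      by (subst nn_integral_cmult[symmetric]) (auto simp: powr_mult ennreal_mult)
    also have "\<dots> \<le> ennreal (\<bar>a\<bar> powr r) * ennreal (Lp_norm p f powr r)"
      using le by (rule mult_left_mono) simp
    also have "\<dots> = ennreal ((\<bar>a\<bar> * Lp_norm p f) powr r)"
      using L0 by (simp add: powr_mult ennreal_mult)
    finally show ?thesis
      using Lp_le_iff_finite[OF r, of "\<bar>a\<bar> * Lp_norm p f" "\<lambda>x. a *\<^sub>R f x"] L0 real by simp
  next
    case PInf
    have "AE x in lebesgue. norm (f x) \<le> Lp_norm p f"
      using Lp_le_iff_infinity[OF L0, of f] f PInf by simp
    then have "AE x in lebesgue. norm (a *\<^sub>R f x) \<le> \<bar>a\<bar> * Lp_norm p f"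
      by (auto elim!: eventually_mono intro: mult_left_mono)
    then show ?thesis
      using Lp_le_iff_infinity[of "\<bar>a\<bar> * Lp_norm p f" "\<lambda>x. a *\<^sub>R f x"] L0 PInf by simp
  qed (use p in auto)
qed

lemma lebesgue_measurable_affine:
  fixes m t :: real
  assumes "m \<noteq> 0"
  shows "(\<lambda>x. t + m * x) \<in> lebesgue \<rightarrow>\<^sub>M lebesgue"
  using lebesgue_affine_measurable[where c = "\<lambda>x::real. m"] assms by simp

text \<open>Lebesgue measure is its own affine image with constant density
  \<open>\<bar>m\<bar> > 0\<close>, so preimages of null sets are null sets.\<close>

lemma AE_lebesgue_affine:
  fixes m t :: real
  assumes "m \<noteq> 0" "AE x in lebesgue. P x"
  shows "AE x in lebesgue. P (t + m * x)"
proof -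
  have "AE x in density (distr lebesgue lebesgue (\<lambda>x. t + m * x)) (\<lambda>_. ennreal \<bar>m\<bar>). P x"
    using assms(2) by (subst lebesgue_real_affine[OF assms(1), of t, symmetric])
  then have "AE x in distr lebesgue lebesgue (\<lambda>x. t + m * x). P x"
    using assms(1) by (simp add: AE_density)
  then obtain Q where Q: "Q \<in> null_sets (distr lebesgue lebesgue (\<lambda>x. t + m * x))" "\<forall>x. x \<notin> Q \<longrightarrow> P x"
    by (elim AE_E3) simp
  have "(\<lambda>x. t + m * x) -` Q \<inter> space lebesgue \<in> null_sets lebesgue"
    using Q(1) lebesgue_measurable_affine[OF assms(1), of t] by (simp add: null_sets_distr_iff)
  then show ?thesis
    by (rule AE_I') (use Q(2) in auto)
qed

text \<open>Substitution multiplies the integral of the power by \<open>1 / m\<close>, hence the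
  norm by \<open>m powr (- 1 / p)\<close>. For infinite \<open>p\<close> the exponent is 0 and the
  factor is 1.\<close>

lemma Lp_affine:
  fixes f :: "real \<Rightarrow> 'a::real_normed_vector"
  assumes p: "1 \<le> p" and f: "in_Lp p f" and m: "0 < m"
  shows "in_Lp p (\<lambda>x. f (m * x + t)) \<and>
    Lp_norm p (\<lambda>x. f (m * x + t)) \<le> m powr (- real_of_ereal (1 / p)) * Lp_norm p f"
proof -
  have [measurable]: "f \<in> borel_measurable lebesgue" using f by (simp add: in_Lp_def)
  have meas[measurable]: "(\<lambda>x. f (m * x + t)) \<in> borel_measurable lebesgue"
    using measurable_compose[OF lebesgue_measurable_affine[of m t], of f] m by (simp add: add.commute)
  have L0: "0 \<le> Lp_norm p f" using f by (rule Lp_norm_nonneg)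
  show ?thesis
  proof (cases p)
    case (real r)
    then have r: "1 \<le> r" using p by simp
    have le: "(\<integral>\<^sup>+x. ennreal (norm (f x) powr r) \<partial>lebesgue) \<le> ennreal (Lp_norm p f powr r)"
      using Lp_le_iff_finite[OF r L0, of f] f real by simp
    \<comment> \<open>Inserting \<open>1 / m * m\<close> creates the Jacobian that the substitution
      rule expects.\<close>
    have "(\<integral>\<^sup>+x. ennreal (norm (f (m * x + t)) powr r) \<partial>lebesgue) =
        ennreal (1 / m) * (ennreal m * (\<integral>\<^sup>+x. ennreal (norm (f (m * x + t)) powr r) \<partial>lebesgue))"
      using m by (simp flip: mult.assoc ennreal_mult)
    also have "ennreal m * (\<integral>\<^sup>+x. ennreal (norm (f (m * x + t)) powr r) \<partial>lebesgue) =
        (\<integral>\<^sup>+x. ennreal (norm (f x) powr r) \<partial>lebesgue)"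
      using m by (subst nn_integral_real_affine_lebesgue[where c = m and t = t]) (auto simp: add.commute)
    also have "ennreal (1 / m) * \<dots> \<le> ennreal (1 / m) * ennreal (Lp_norm p f powr r)"
      using le by (rule mult_left_mono) simp
    also have "\<dots> = ennreal (1 / m * Lp_norm p f powr r)"
      using m by (subst ennreal_mult) auto
    also have "1 / m * Lp_norm p f powr r = (m powr (- (1 / r)) * Lp_norm p f) powr r"
      using L0 m r by (simp add: powr_mult powr_powr powr_minus_divide powr_divide)
    finally have "(\<integral>\<^sup>+x. ennreal (norm (f (m * x + t)) powr r) \<partial>lebesgue) \<le>
        ennreal ((m powr (- (1 / r)) * Lp_norm p f) powr r)" .
    moreover have "real_of_ereal (1 / p) = 1 / r"
      using real r by (simp add: one_ereal_def)
    ultimately show ?thesis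
      using Lp_le_iff_finite[OF r, of "m powr (- (1 / r)) * Lp_norm p f" "\<lambda>x. f (m * x + t)"] L0 real
      by simp
  next
    case PInf
    have "AE x in lebesgue. norm (f x) \<le> Lp_norm p f"
      using Lp_le_iff_infinity[OF L0, of f] f PInf by simp
    then have "AE x in lebesgue. norm (f (t + m * x)) \<le> Lp_norm p f"
      using m by (intro AE_lebesgue_affine) auto
    then show ?thesis
      using Lp_le_iff_infinity[of "Lp_norm p f" "\<lambda>x. f (m * x + t)"] meas L0 PInf m
      by (simp add: add.commute[of t])
  qed (use p in auto)
qed

text \<open>All terms of the series have norm at most \<open>V\<close>, so Jensen's inequality with the weights
  \<open>norm (c k)\<close> replaces Minkowski's inequality, also for the infinite sum.\<close>

lemma Lp_series_bound:
  fixes c :: "'i::countable \<Rightarrow> complex" and v :: "'i \<Rightarrow> real \<Rightarrow> complex"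
  assumes p: "1 \<le> p" and v: "\<And>k. in_Lp p (v k)" "\<And>k. Lp_norm p (v k) \<le> V"
    and c: "integrable (count_space UNIV) c"
  defines "A \<equiv> LINT k|count_space UNIV. norm (c k)"
    and "s \<equiv> \<lambda>x. LINT k|count_space UNIV. c k * v k x"
  shows "AE x in lebesgue. integrable (count_space UNIV) (\<lambda>k. c k * v k x)"
    and "s \<in> borel_measurable lebesgue"
    and "in_Lp p s \<and> Lp_norm p s \<le> A * V"
proof -
  interpret C: sigma_finite_measure "count_space (UNIV :: 'i set)"
    by (rule sigma_finite_measure_count_space_countable) simp
  have vm[measurable]: "v k \<in> borel_measurable lebesgue" for k
    using v(1)[of k] by (simp add: in_Lp_def)
  \<comment> \<open>Joint measurability follows from that of the slices because the index type is
    countable.\<close>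
  have pairm: "(\<lambda>(x, k). g k x) \<in> borel_measurable (lebesgue \<Otimes>\<^sub>M count_space (UNIV :: 'i set))"
    if "\<And>k. g k \<in> borel_measurable lebesgue" for g :: "'i \<Rightarrow> real \<Rightarrow> 'b::topological_space"
  proof -
    have "(\<lambda>x. g (snd x) (fst x)) \<in> borel_measurable (lebesgue \<Otimes>\<^sub>M count_space (UNIV :: 'i set))"
      by (rule measurable_compose_countable'[where f = "\<lambda>k x. g k (fst x)" and g = snd and I = UNIV])
         (use that in auto)
    then show ?thesis by (simp add: case_prod_beta')
  qed
  have "(\<lambda>(x, k). c k * v k x) \<in> borel_measurable (lebesgue \<Otimes>\<^sub>M count_space (UNIV :: 'i set))"
    by (rule pairm) measurable
  then show sm[measurable]: "s \<in> borel_measurable lebesgue"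
    unfolding s_def by (rule C.borel_measurable_lebesgue_integral)
  have V0: "0 \<le> V" using Lp_norm_nonneg[OF v(1)] v(2) order_trans by blast
  have A0: "0 \<le> A" unfolding A_def by (simp add: integral_nonneg_AE)
  have nc: "integrable (count_space UNIV) (\<lambda>k. norm (c k))" using c by simp
  have "(AE x in lebesgue. integrable (count_space UNIV) (\<lambda>k. c k * v k x)) \<and>
      in_Lp p s \<and> Lp_norm p s \<le> A * V"
  proof (cases p)
    case (real r)
    then have r: "1 \<le> r" using p by simp
    define G where "G x = (LINT k|count_space UNIV. norm (c k) * norm (v k x) powr r)" for x
    have le: "(\<integral>\<^sup>+x. ennreal (norm (v k x) powr r) \<partial>lebesgue) \<le> ennreal (V powr r)" for k
      using Lp_le_iff_finite[OF r V0, of "v k"] v real by simp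
    let ?N = "\<lambda>x. \<integral>\<^sup>+k. ennreal (norm (c k) * norm (v k x) powr r) \<partial>count_space UNIV"
    have "(\<integral>\<^sup>+x. ?N x \<partial>lebesgue) =
        (\<integral>\<^sup>+k. \<integral>\<^sup>+x. ennreal (norm (c k) * norm (v k x) powr r) \<partial>lebesgue \<partial>count_space UNIV)"
      by (rule nn_integral_count_space_nn_integral) auto
    also have "\<dots> = (\<integral>\<^sup>+k. ennreal (norm (c k)) * (\<integral>\<^sup>+x. ennreal (norm (v k x) powr r) \<partial>lebesgue) \<partial>count_space UNIV)"
      by (subst nn_integral_cmult[symmetric]) (auto simp: ennreal_mult)
    also have "\<dots> \<le> (\<integral>\<^sup>+k. ennreal (norm (c k)) * ennreal (V powr r) \<partial>count_space UNIV)"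
      using le by (intro nn_integral_mono mult_left_mono) auto
    also have "\<dots> = ennreal A * ennreal (V powr r)"
      using nc by (simp add: nn_integral_multc nn_integral_eq_integral A_def)
    \<comment> \<open>This bound serves twice: it makes \<open>?N\<close> finite almost everywhere,
      hence the series absolutely convergent there, and it closes the norm estimate.\<close>
    finally have N: "(\<integral>\<^sup>+x. ?N x \<partial>lebesgue) \<le> ennreal A * ennreal (V powr r)" .
    have Nm: "?N \<in> borel_measurable lebesgue"
      by (rule C.borel_measurable_nn_integral, rule pairm) measurable
    have "(\<integral>\<^sup>+x. ?N x \<partial>lebesgue) < top"
      using N by (rule le_less_trans) (simp add: ennreal_mult_less_top)
    then have "AE x in lebesgue. ?N x \<noteq> \<infinity>"
      by (intro nn_integral_noteq_infinite[OF Nm]) auto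
    then have int: "AE x in lebesgue. integrable (count_space UNIV) (\<lambda>k. norm (c k) * norm (v k x) powr r)"
      by (auto elim!: eventually_mono simp: integrable_iff_bounded less_top)
    have pt: "AE x in lebesgue. integrable (count_space UNIV) (\<lambda>k. c k * v k x) \<and>
        ennreal (norm (s x) powr r) \<le> ennreal (A powr (r - 1)) * ?N x"
      using int
    proof eventually_elim
      case (elim x)
      \<comment> \<open>Jensen at a fixed point \<open>x\<close>, for counting measure with weights
        \<open>norm (c k)\<close>.\<close>
      note J = weighted_Jensen_powr[OF r nc _ _ _ elim]
      have I: "integrable (count_space UNIV) (\<lambda>k. norm (c k) * norm (v k x))"
        by (rule J(1)) auto
      then have I': "integrable (count_space UNIV) (\<lambda>k. c k * v k x)"
        by (subst (asm) norm_mult[symmetric]) (simp add: integrable_norm_iff)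
      have "norm (s x) \<le> (LINT k|count_space UNIV. norm (c k * v k x))"
        unfolding s_def by (rule integral_norm_bound)
      then have "norm (s x) powr r \<le> (LINT k|count_space UNIV. norm (c k) * norm (v k x)) powr r"
        using r by (intro powr_mono2) (auto simp: norm_mult)
      also have "\<dots> \<le> A powr (r - 1) * (LINT k|count_space UNIV. norm (c k) * norm (v k x) powr r)"
        unfolding A_def by (rule J(2)) auto
      finally have "ennreal (norm (s x) powr r) \<le>
          ennreal (A powr (r - 1) * (LINT k|count_space UNIV. norm (c k) * norm (v k x) powr r))"
        by (rule ennreal_leI)
      also have "\<dots> = ennreal (A powr (r - 1)) * ?N x"
        using elim by (subst nn_integral_eq_integral) (auto simp: ennreal_mult integral_nonneg_AE)
      finally show ?case using I' by simp
    qed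
    then have "(\<integral>\<^sup>+x. ennreal (norm (s x) powr r) \<partial>lebesgue) \<le>
        (\<integral>\<^sup>+x. ennreal (A powr (r - 1)) * ?N x \<partial>lebesgue)"
      by (intro nn_integral_mono_AE) (auto elim!: eventually_mono)
    also have "\<dots> = ennreal (A powr (r - 1)) * (\<integral>\<^sup>+x. ?N x \<partial>lebesgue)"
      by (rule nn_integral_cmult[OF Nm])
    also have "\<dots> \<le> ennreal (A powr (r - 1)) * (ennreal A * ennreal (V powr r))"
      using N by (rule mult_left_mono) simp
    also have "\<dots> = ennreal ((A * V) powr r)"
    proof -
      have "A powr (r - 1) * A = A powr r"
        using A0 by (cases "A = 0") (auto simp: powr_mult_base mult.commute)
      moreover have "ennreal (A powr (r - 1)) * (ennreal A * ennreal (V powr r)) =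
          ennreal (A powr (r - 1) * A * V powr r)"
        using A0 by (simp add: ennreal_mult mult.assoc)
      ultimately show ?thesis using A0 V0 by (simp add: powr_mult)
    qed
    finally have "in_Lp p s \<and> Lp_norm p s \<le> A * V"
      using Lp_le_iff_finite[OF r, of "A * V" s] A0 V0 real by simp
    with pt show ?thesis by (auto elim!: eventually_mono)
  next
    case PInf
    have "AE x in lebesgue. norm (v k x) \<le> V" for k
      using Lp_le_iff_infinity[OF V0, of "v k"] v PInf by simp
    then have "AE x in lebesgue. \<forall>k. norm (v k x) \<le> V"
      by (simp add: AE_all_countable)
    then have pt: "AE x in lebesgue. integrable (count_space UNIV) (\<lambda>k. c k * v k x) \<and> norm (s x) \<le> A * V"
    proof eventually_elim
      case (elim x)
      have b: "norm (c k * v k x) \<le> norm (c k) * V" for k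
        using elim by (auto simp: norm_mult intro: mult_left_mono)
      have cV: "integrable (count_space UNIV) (\<lambda>k. norm (c k) * V)" using nc by simp
      have I: "integrable (count_space UNIV) (\<lambda>k. c k * v k x)"
        using cV by (rule Bochner_Integration.integrable_bound) (use b V0 in auto)
      have "norm (s x) \<le> (LINT k|count_space UNIV. norm (c k * v k x))"
        unfolding s_def by (rule integral_norm_bound)
      also have "\<dots> \<le> (LINT k|count_space UNIV. norm (c k) * V)"
        using b I cV by (intro integral_mono) auto
      also have "\<dots> = A * V" by (simp add: A_def)
      finally show ?case using I by simp
    qed
    then show ?thesis
      using Lp_le_iff_infinity[of "A * V" s] A0 V0 PInf by (auto elim!: eventually_mono)
  qed (use p in auto)
  then show "AE x in lebesgue. integrable (count_space UNIV) (\<lambda>k. c k * v k x)"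
    and "in_Lp p s \<and> Lp_norm p s \<le> A * V"
    by auto
qed

text \<open>Up to sign, the error of a finite partial sum is the series with the coefficients in
  \<open>F\<close> set to zero. Its norm is at most \<open>V\<close> times the remaining mass of
  \<open>c\<close>, which tends to 0.\<close>

lemma Lp_has_sum_series:
  fixes c :: "'i::countable \<Rightarrow> complex" and v :: "'i \<Rightarrow> real \<Rightarrow> complex"
  assumes p: "1 \<le> p" and v: "\<And>k. in_Lp p (v k)" "\<And>k. Lp_norm p (v k) \<le> V"
    and c: "integrable (count_space UNIV) c"
  defines "s \<equiv> \<lambda>x. LINT k|count_space UNIV. c k * v k x"
  shows "Lp_has_sum p (\<lambda>k x. c k * v k x) s"
proof -
  have vm[measurable]: "v k \<in> borel_measurable lebesgue" for k
    using v(1)[of k] by (simp add: in_Lp_def)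
  \<comment> \<open>Finite sums are written as integrals over all indices so that they can be
    subtracted from the full series.\<close>
  have sums: "integrable (count_space UNIV) (\<lambda>k. indicator F k *\<^sub>R g k) \<and>
      (LINT k|count_space UNIV. indicator F k *\<^sub>R g k) = (\<Sum>k\<in>F. g k)"
    if "finite F" for F and g :: "'i \<Rightarrow> 'b::{banach, second_countable_topology}"
  proof
    have "integrable (count_space F) g" using that by (rule integrable_count_space)
    then show "integrable (count_space UNIV) (\<lambda>k. indicator F k *\<^sub>R g k)"
      by (simp add: integrable_restrict_space[symmetric] restrict_count_space)
    have "(LINT k|count_space UNIV. indicator F k *\<^sub>R g k) = (LINT k|count_space F. g k)"
      by (simp add: integral_restrict_space[symmetric] restrict_count_space)
    then show "(LINT k|count_space UNIV. indicator F k *\<^sub>R g k) = (\<Sum>k\<in>F. g k)"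
      using that by (simp add: lebesgue_integral_count_space_finite)
  qed
  define A where "A F = (LINT k|count_space UNIV. norm (indicator (- F) k *\<^sub>R c k))" for F
  have V0: "0 \<le> V" using Lp_norm_nonneg[OF v(1)] v(2) order_trans by blast
  have AF: "A F = (LINT k|count_space UNIV. norm (c k)) - (\<Sum>k\<in>F. norm (c k))" if "finite F" for F
  proof -
    have "A F = (LINT k|count_space UNIV. norm (c k) - indicator F k *\<^sub>R norm (c k))"
      unfolding A_def by (intro Bochner_Integration.integral_cong) (auto split: split_indicator)
    also have "\<dots> = (LINT k|count_space UNIV. norm (c k)) - (\<Sum>k\<in>F. norm (c k))"
      using c sums[OF that, of "\<lambda>k. norm (c k)"] by (subst Bochner_Integration.integral_diff) auto
    finally show ?thesis .
  qed
  have bound: "0 \<le> Lp_norm p (\<lambda>x. (\<Sum>k\<in>F. c k * v k x) - s x)"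
    "Lp_norm p (\<lambda>x. (\<Sum>k\<in>F. c k * v k x) - s x) \<le> A F * V" if F: "finite F" for F
  proof -
    let ?c = "\<lambda>k. indicator (- F) k *\<^sub>R c k"
    let ?s = "\<lambda>x. LINT k|count_space UNIV. ?c k * v k x"
    have ci: "integrable (count_space UNIV) ?c"
      using c by (rule Bochner_Integration.integrable_bound) (auto split: split_indicator)
    note b = Lp_series_bound[OF p v ci] and b0 = Lp_series_bound[OF p v c]
    have [measurable]: "s \<in> borel_measurable lebesgue" using b0(2) by (simp add: s_def)
    have "AE x in lebesgue. norm ((\<Sum>k\<in>F. c k * v k x) - s x) = norm (?s x)"
      using b0(1)
    proof (rule eventually_mono)
      fix x assume elim: "integrable (count_space UNIV) (\<lambda>k. c k * v k x)"
      have "?s x = (LINT k|count_space UNIV. c k * v k x - indicator F k *\<^sub>R (c k * v k x))"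
        by (intro Bochner_Integration.integral_cong) (auto split: split_indicator)
      also have "\<dots> = s x - (\<Sum>k\<in>F. c k * v k x)"
        using elim sums[OF F, of "\<lambda>k. c k * v k x"] unfolding s_def
        by (subst Bochner_Integration.integral_diff) auto
      finally show "norm ((\<Sum>k\<in>F. c k * v k x) - s x) = norm (?s x)"
        by (simp add: norm_minus_commute)
    qed
    then have "Lp_norm p (\<lambda>x. (\<Sum>k\<in>F. c k * v k x) - s x) = Lp_norm p ?s"
      using b(2) by (intro Lp_norm_cong_AE) auto
    with b(3) show "0 \<le> Lp_norm p (\<lambda>x. (\<Sum>k\<in>F. c k * v k x) - s x)"
      "Lp_norm p (\<lambda>x. (\<Sum>k\<in>F. c k * v k x) - s x) \<le> A F * V"
      using Lp_norm_nonneg[of p ?s] by (simp_all add: A_def)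
  qed
  have in_s: "in_Lp p s" using Lp_series_bound(3)[OF p v c] by (simp add: s_def)
  have in_cv: "in_Lp p (\<lambda>x. c k * v k x)" for k
  proof -
    \<comment> \<open>A single term is the series whose coefficients vanish except at
      \<open>k\<close>, so the same bound covers it.\<close>
    have "integrable (count_space UNIV) (\<lambda>l. indicator {k} l *\<^sub>R c l)" using sums[of "{k}" c] by simp
    from Lp_series_bound(3)[OF p v this]
    have "in_Lp p (\<lambda>x. LINT l|count_space UNIV. indicator {k} l *\<^sub>R (c l * v l x))" by simp
    with sums[of "{k}" "\<lambda>l. c l * v l _"] show ?thesis by simp
  qed
  have "((\<lambda>F. \<Sum>k\<in>F. norm (c k)) \<longlongrightarrow> (LINT k|count_space UNIV. norm (c k))) (finite_subsets_at_top UNIV)"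
  proof -
    have ab: "Infinite_Set_Sum.abs_summable_on (\<lambda>k. norm (c k)) UNIV"
      using c by (simp add: Infinite_Set_Sum.abs_summable_on_def)
    then have "(\<lambda>k. norm (c k)) summable_on UNIV"
      using abs_summable_equivalent abs_summable_summable by blast
    then show ?thesis
      using infsum_tendsto infsetsum_infsum[OF ab] by (simp add: infsetsum_def)
  qed
  then have lim: "((\<lambda>F. ((LINT k|count_space UNIV. norm (c k)) - (\<Sum>k\<in>F. norm (c k))) * V) \<longlongrightarrow>
      ((LINT k|count_space UNIV. norm (c k)) - (LINT k|count_space UNIV. norm (c k))) * V) (finite_subsets_at_top UNIV)"
    by (intro tendsto_intros)
  have "((\<lambda>F. Lp_norm p (\<lambda>x. (\<Sum>k\<in>F. c k * v k x) - s x)) \<longlongrightarrow> 0) (finite_subsets_at_top UNIV)"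
  proof (rule tendsto_sandwich[OF _ _ tendsto_const])
    show "\<forall>\<^sub>F F in finite_subsets_at_top UNIV. 0 \<le> Lp_norm p (\<lambda>x. (\<Sum>k\<in>F. c k * v k x) - s x)"
      using bound(1) by (intro eventually_finite_subsets_at_top_weakI)
    show "\<forall>\<^sub>F F in finite_subsets_at_top UNIV. Lp_norm p (\<lambda>x. (\<Sum>k\<in>F. c k * v k x) - s x) \<le>
        ((LINT k|count_space UNIV. norm (c k)) - (\<Sum>k\<in>F. norm (c k))) * V"
      using bound(2) by (intro eventually_finite_subsets_at_top_weakI) (metis AF)
    show "((\<lambda>F. ((LINT k|count_space UNIV. norm (c k)) - (\<Sum>k\<in>F. norm (c k))) * V) \<longlongrightarrow> 0) (finite_subsets_at_top UNIV)"
      using lim by simp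
  qed
  with in_s in_cv show ?thesis by (simp add: Lp_has_sum_def)
qed

section \<open>The final estimate with an explicit constant\<close>

theorem theorem15:
  fixes p :: ereal and h :: real and N :: nat and M :: int
    and \<phi> f :: "real \<Rightarrow> complex"
  assumes "1 \<le> p" and "0 < h" and "2 \<le> M"
    and "in_Lp p \<phi>"
    and "sobolev_W1 (N + 1) f" and "cont_diff N f"
  shows "\<exists>C::real. \<forall>j::nat. \<exists>s.
    Lp_has_sum p (\<lambda>k::int. \<lambda>x. eps_coeff h N M f j (- k) * scaled_shift M \<phi> j k x) s \<and>
    Lp_norm p (\<lambda>x. (of_int M powr (- (real j / 2))) *\<^sub>R s x)
      \<le> C * of_int M powr (- (real j * (real N + real_of_ereal (1 / p))))"
proof -
  obtain g where g: "integrable lebesgue g" "weak_deriv (Suc N) f g"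
    using assms(5) by (auto simp: sobolev_W1_def)
  define q where "q = real_of_ereal (1 / p)"
  define G where "G = (2 * h + 1) * (LINT x|lebesgue. norm (g x))"
  define m :: real where "m = of_int M"
  have m: "0 < m" using assms(3) by (simp add: m_def)
  have \<phi>0: "0 \<le> Lp_norm p \<phi>" using assms(4) by (rule Lp_norm_nonneg)
  show ?thesis
  \<comment> \<open>The factor \<open>h ^ N\<close> comes from the Taylor remainder and
    \<open>G\<close> from the overlap of the intervals.\<close>
  proof (intro exI[of _ "h ^ N * G * Lp_norm p \<phi>"] allI)
    fix j :: nat
    let ?c = "\<lambda>k. eps_coeff h N M f j (- k)"
    define A where "A = (LINT k|count_space UNIV. norm (?c k))"
    define V where "V = m powr (real j / 2) * ((m ^ j) powr (- q) * Lp_norm p \<phi>)"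
    have c: "integrable (count_space UNIV) ?c" and A: "A \<le> (h / m ^ j) ^ N * G"
      using summable_eps_coeff[OF assms(6) g assms(2), of M j] assms(3) by (auto simp: A_def G_def m_def)
    have A0: "0 \<le> A" by (simp add: A_def integral_nonneg_AE)
    have v: "in_Lp p (scaled_shift M \<phi> j k)" "Lp_norm p (scaled_shift M \<phi> j k) \<le> V" for k
    proof -
      have shift: "in_Lp p (\<lambda>x. \<phi> (m ^ j * x + of_int k))"
        "Lp_norm p (\<lambda>x. \<phi> (m ^ j * x + of_int k)) \<le> (m ^ j) powr (- q) * Lp_norm p \<phi>"
        using Lp_affine[OF assms(1,4), of "m ^ j" "of_int k"] m by (auto simp: q_def)
      have eq: "scaled_shift M \<phi> j k = (\<lambda>x. (m powr (real j / 2)) *\<^sub>R \<phi> (m ^ j * x + of_int k))"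
        by (simp add: scaled_shift_def m_def fun_eq_iff)
      note scale = Lp_scaleR[OF assms(1) shift(1), of "m powr (real j / 2)"]
      show "in_Lp p (scaled_shift M \<phi> j k)" using scale by (simp add: eq)
      have "Lp_norm p (scaled_shift M \<phi> j k) \<le> m powr (real j / 2) * Lp_norm p (\<lambda>x. \<phi> (m ^ j * x + of_int k))"
        using scale by (simp add: eq)
      also have "\<dots> \<le> V" unfolding V_def using shift(2) by (intro mult_left_mono) auto
      finally show "Lp_norm p (scaled_shift M \<phi> j k) \<le> V" .
    qed
    \<comment> \<open>The pointwise sum; the integral defaults to 0 where the series is not
      absolutely convergent, which happens only on a null set.\<close>
    define s where "s x = (LINT k|count_space UNIV. ?c k * scaled_shift M \<phi> j k x)" for x
    have "Lp_has_sum p (\<lambda>k x. ?c k * scaled_shift M \<phi> j k x) s"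
      unfolding s_def[abs_def] by (rule Lp_has_sum_series[OF assms(1) v c])
    moreover have "Lp_norm p (\<lambda>x. (m powr (- (real j / 2))) *\<^sub>R s x)
        \<le> (h ^ N * G * Lp_norm p \<phi>) * m powr (- (real j * (real N + q)))"
    proof -
      have s: "in_Lp p s" "Lp_norm p s \<le> A * V"
        using Lp_series_bound(3)[OF assms(1) v c] by (auto simp: s_def[abs_def] A_def)
      have "Lp_norm p (\<lambda>x. (m powr (- (real j / 2))) *\<^sub>R s x) \<le> m powr (- (real j / 2)) * Lp_norm p s"
        using Lp_scaleR[OF assms(1) s(1), of "m powr (- (real j / 2))"] by simp
      also have "\<dots> \<le> m powr (- (real j / 2)) * (A * V)"
        using s(2) by (intro mult_left_mono) auto
      \<comment> \<open>The normalising factor cancels \<open>m powr (real j / 2)\<close> from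
        \<open>V\<close>.\<close>
      also have "\<dots> = A * ((m ^ j) powr (- q) * Lp_norm p \<phi>)"
        using m by (simp add: V_def powr_minus)
      also have "\<dots> \<le> ((h / m ^ j) ^ N * G) * ((m ^ j) powr (- q) * Lp_norm p \<phi>)"
        using A \<phi>0 by (intro mult_right_mono) auto
      also have "\<dots> = (h ^ N * G * Lp_norm p \<phi>) * (inverse ((m ^ j) ^ N) * (m ^ j) powr (- q))"
        by (simp add: power_divide divide_inverse power_mult_distrib power_inverse mult_ac)
      \<comment> \<open>The rate \<open>j * N\<close> stems from the coefficients and
        \<open>j * q\<close> from the dilation of \<open>\<phi>\<close>.\<close>
      also have "inverse ((m ^ j) ^ N) * (m ^ j) powr (- q) = m powr (- (real j * (real N + q)))"
        using m by (simp add: powr_realpow[symmetric] powr_powr powr_minus[symmetric] powr_add[symmetric] algebra_simps)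
      finally show ?thesis .
    qed
    ultimately show "\<exists>s. Lp_has_sum p (\<lambda>k x. ?c k * scaled_shift M \<phi> j k x) s \<and>
        Lp_norm p (\<lambda>x. (of_int M powr (- (real j / 2))) *\<^sub>R s x)
        \<le> (h ^ N * G * Lp_norm p \<phi>) * of_int M powr (- (real j * (real N + real_of_ereal (1 / p))))"
      unfolding m_def q_def by blast
  qed
qed

end
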